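(* (Negative Havrda-Charvát-Tsallis entropy.) Let $n\in\mathbb N$, let $X:=\mathbb R^n$ with an arbitrary norm $\|\cdot\|$, let $U:=(0,\infty)^n$, and fix $q\in\mathbb R\setminus\{0,1\}$. Define $b:X\to(-\infty,\infty]$ as follows: if $q\in(0,1)\cup(1,\infty)$, then $b(x):=\frac1{q-1}\sum_{k=1}^n(x_k^q-1)$ for $x\in\overline U=[0,\infty)^n$ and $b(x):=\infty$ otherwise; if $q<0$, then $b(x):=\frac1{1-q}\sum_{k=1}^n(x_k^q-1)$ for $x\in U$ and $b(x):=\infty$ otherwise. Let $c_2,c_\infty>0$ be constants with $c_2\|v\|\le\|v\|_2$ and $\|v\|_\infty\le c_\infty\|v\|$ for all $v\in X$. Then: (a) If $q=2$, then $b$ is strongly convex on $\overline U$ with $2c_2^2$ as a strong convexity parameter. If $q\in(-\infty,0)\cup(0,1)\cup(1,2)$, then $b$ is strongly convex on every nonempty, bounded and convex subset of $\mathrm{dom}(b)$; moreover, if $S$ is a nonempty, bounded and convex subset of $U$ and $M_S$ is an upper bound on the norms of the vectors in $S$, then $\mu[S]:=|q|c_2^2/(c_\infty M_S)^{2-q}$ is a strong convexity parameter of $b$ on $S$. If $q>2$, then $b$ is strongly convex on every nonempty subset $V$ of $U$ whose distance to the boundary of $U$ is positive. (b) If $q\in(-\infty,0)\cup(0,1)\cup(1,2)$, then for each $x\in\mathrm{dom}(b)$, $b$ is uniformly convex relative to $(\{x\},U\cap\{w\in X:\|w\|>2\|x\|\})$ with relative gauge $\psi(t):=\frac{|q|c_2^2}{c_\infty^{2-q}2^{3-q}}t^q$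 for $t>0$, $\psi(0):=0$. (c) If $q\in(0,\infty)\setminus\{1,2\}$, then $b$ is not strongly convex on $U$. If $q=\frac12$, then $b$ is not uniformly convex on $U$. (d) If $q\in(0,1)\cup(1,\infty)$, then $b$ is a sequentially consistent Bregman function (with zone $U$) which has the limiting difference property, and for all $y\in U$ and $\gamma\in\mathbb R$ the second type level-set $\{x\in\mathrm{dom}(b):B(x,y)\le\gamma\}$ is bounded. If $q<0$, then $b$ is not a Bregman function.
   Context: $\|v\|_2$ and $\|v\|_\infty$ are the Euclidean and max norms. $\mathrm{dom}(b):=\{x\in X:b(x)<\infty\}$. For convex $b$ and nonempty $S_1,S_2\subseteq\mathrm{dom}(b)$ (not necessarily convex), $b$ is uniformly convex relative to $(S_1,S_2)$ with relative gauge $\psi:[0,\infty)\to[0,\infty]$ (where $\psi(t)>0$ for $t>0$) if $b(\lambda x+(1-\lambda)y)+\lambda(1-\lambda)\psi(\|x-y\|)\le\lambda b(x)+(1-\lambda)b(y)$ for all $\lambda\in(0,1)$, $(x,y)\in S_1\times S_2$. If $S_1=S_2=S$, $b$ is uniformly convex on $S$; if also $\psi(t)=\frac12\mu t^2$ with $\mu>0$, $b$ is strongly convex on $S$ with strong convexity parameter $\mu$. Divergence: $B(x,y):=b(x)-b(y)-\langle b'(y),x-y\rangle$ for $(x,y)\in\mathrm{dom}(b)\times U$, and $B(x,y):=\infty$ otherwise, where $b'$ is the (Gâteaux) derivative. $b$ is a Bregman function with zone $U$ if: (i) $U=\mathrm{Int}(\mathrm{dom}(b))\ne\emptyset$ and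 $b$ is Gâteaux differentiable in $U$; (ii) $b$ is convex and lower semicontinuous on $X$ and strictly convex on $\mathrm{dom}(b)$; (iii) for each $\gamma\in\mathbb R$ and $x\in\mathrm{dom}(b)$ the set $\{y\in U:B(x,y)\le\gamma\}$ is bounded; (iv) if $x\in\mathrm{dom}(b)$ and $(y_i)$ in $U$ satisfy $\|x-y_i\|\to0$, then $B(x,y_i)\to0$; (v) if $(x_i)$ is a bounded sequence in $\mathrm{dom}(b)$, $(y_i)$ is a sequence in $U$, $B(x_i,y_i)\to0$ and $\|y_i-y\|\to0$ for some $y\in\mathrm{dom}(b)$, then $\|x_i-y\|\to0$. $b$ has the limiting difference property if for each $x\in\mathrm{dom}(b)$ and each sequence $(y_i)$ in $U$ converging (weakly) to some $y\in U$, $B(x,y)=\lim_{i\to\infty}(B(x,y_i)-B(y,y_i))$. $b$ is sequentially consistent if for all sequences $(x_i)$ in $\mathrm{dom}(b)$ and $(y_i)$ in $U$ with $(y_i)$ bounded and $B(x_i,y_i)\to0$ one has $\|x_i-y_i\|\to0$. *)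

theory Defs
  imports "HOL-Analysis.Analysis"
begin

text \<open>
  The norm of the ambient space is an explicit parameter \<open>N\<close>, because a type has only one norm
  of its class (on \<open>real ^ 'n\<close> it is the Euclidean one), whereas here the norm is arbitrary.
  All metric and topological notions below are taken with respect to \<open>N\<close>.
\<close>

definition is_norm :: "('a::real_vector \<Rightarrow> real) \<Rightarrow> bool" where
  "is_norm N \<longleftrightarrow>
     (\<forall>x. 0 \<le> N x) \<and> (\<forall>x. N x = 0 \<longleftrightarrow> x = 0) \<and>
     (\<forall>a x. N (a *\<^sub>R x) = \<bar>a\<bar> * N x) \<and> (\<forall>x y. N (x + y) \<le> N x + N y)"

definition norm_topology :: "('a::real_vector \<Rightarrow> real) \<Rightarrow> 'a topology" where
  "norm_topology N = Metric_space.mtopology UNIV (\<lambda>x y. N (x - y))"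

definition norm_bounded :: "('a::real_vector \<Rightarrow> real) \<Rightarrow> 'a set \<Rightarrow> bool" where
  "norm_bounded N S \<longleftrightarrow> (\<exists>M. \<forall>x\<in>S. N x \<le> M)"

text \<open>Only meaningful for nonempty \<open>A\<close> and \<open>B\<close>.\<close>

definition norm_setdist :: "('a::real_vector \<Rightarrow> real) \<Rightarrow> 'a set \<Rightarrow> 'a set \<Rightarrow> real" where
  "norm_setdist N A B = Inf {N (x - y) |x y. x \<in> A \<and> y \<in> B}"

definition dual_space :: "('a::real_vector \<Rightarrow> real) \<Rightarrow> ('a \<Rightarrow> real) set" where
  "dual_space N = {f. linear f \<and> (\<exists>K. \<forall>x. \<bar>f x\<bar> \<le> K * N x)}"

definition weakly_converges :: "('a::real_vector \<Rightarrow> real) \<Rightarrow> (nat \<Rightarrow> 'a) \<Rightarrow> 'a \<Rightarrow> bool" where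
  "weakly_converges N y l \<longleftrightarrow> (\<forall>f\<in>dual_space N. (\<lambda>i. f (y i)) \<longlonglongrightarrow> f l)"


text \<open>Functions \<open>X \<rightarrow> (-\<infinity>, \<infinity>]\<close> are rendered as functions into \<open>ereal\<close>.\<close>

definition dom_of :: "('a \<Rightarrow> ereal) \<Rightarrow> 'a set" where
  "dom_of b = {x. b x < \<infinity>}"

definition proper_values :: "('a \<Rightarrow> ereal) \<Rightarrow> bool" where
  "proper_values b \<longleftrightarrow> (\<forall>x. b x \<noteq> - \<infinity>)"

definition econvex :: "('a::real_vector \<Rightarrow> ereal) \<Rightarrow> bool" where
  "econvex b \<longleftrightarrow>
     (\<forall>x y. \<forall>\<alpha>\<in>{0<..<1::real}.
        b (\<alpha> *\<^sub>R x + (1 - \<alpha>) *\<^sub>R y) \<le> ereal \<alpha> * b x + ereal (1 - \<alpha>) * b y)"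

definition estrictly_convex_on :: "'a::real_vector set \<Rightarrow> ('a \<Rightarrow> ereal) \<Rightarrow> bool" where
  "estrictly_convex_on S b \<longleftrightarrow>
     (\<forall>x\<in>S. \<forall>y\<in>S. x \<noteq> y \<longrightarrow> (\<forall>\<alpha>\<in>{0<..<1::real}.
        b (\<alpha> *\<^sub>R x + (1 - \<alpha>) *\<^sub>R y) < ereal \<alpha> * b x + ereal (1 - \<alpha>) * b y))"

definition lower_semicontinuous :: "('a::real_vector \<Rightarrow> real) \<Rightarrow> ('a \<Rightarrow> ereal) \<Rightarrow> bool" where
  "lower_semicontinuous N b \<longleftrightarrow>
     (\<forall>x. \<forall>c. c < b x \<longrightarrow> eventually (\<lambda>y. c < b y) (nhdsin (norm_topology N) x))"


subsection \<open>Relative uniform convexity\<close>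

definition uniformly_convex_rel ::
  "('a::real_vector \<Rightarrow> real) \<Rightarrow> ('a \<Rightarrow> ereal) \<Rightarrow> 'a set \<Rightarrow> 'a set \<Rightarrow> (real \<Rightarrow> ereal) \<Rightarrow> bool" where
  "uniformly_convex_rel N b S1 S2 \<psi> \<longleftrightarrow>
     econvex b \<and> S1 \<noteq> {} \<and> S2 \<noteq> {} \<and> S1 \<subseteq> dom_of b \<and> S2 \<subseteq> dom_of b \<and>
     (\<forall>t\<ge>0. 0 \<le> \<psi> t) \<and> (\<forall>t>0. 0 < \<psi> t) \<and>
     (\<forall>\<alpha>\<in>{0<..<1::real}. \<forall>x\<in>S1. \<forall>y\<in>S2.
        b (\<alpha> *\<^sub>R x + (1 - \<alpha>) *\<^sub>R y) + ereal (\<alpha> * (1 - \<alpha>)) * \<psi> (N (x - y))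
          \<le> ereal \<alpha> * b x + ereal (1 - \<alpha>) * b y)"

definition uniformly_convex_on ::
  "('a::real_vector \<Rightarrow> real) \<Rightarrow> ('a \<Rightarrow> ereal) \<Rightarrow> 'a set \<Rightarrow> bool" where
  "uniformly_convex_on N b S \<longleftrightarrow> (\<exists>\<psi>. uniformly_convex_rel N b S S \<psi>)"

definition strong_convexity_parameter ::
  "('a::real_vector \<Rightarrow> real) \<Rightarrow> ('a \<Rightarrow> ereal) \<Rightarrow> 'a set \<Rightarrow> real \<Rightarrow> bool" where
  "strong_convexity_parameter N b S \<mu> \<longleftrightarrow>
     0 < \<mu> \<and> uniformly_convex_rel N b S S (\<lambda>t. ereal (1/2 * \<mu> * t^2))"

definition strongly_convex_on ::
  "('a::real_vector \<Rightarrow> real) \<Rightarrow> ('a \<Rightarrow> ereal) \<Rightarrow> 'a set \<Rightarrow> bool" where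
  "strongly_convex_on N b S \<longleftrightarrow> (\<exists>\<mu>. strong_convexity_parameter N b S \<mu>)"


subsection \<open>Bregman functions\<close>

definition has_gateaux_derivative ::
  "('a::real_vector \<Rightarrow> real) \<Rightarrow> ('a \<Rightarrow> ereal) \<Rightarrow> ('a \<Rightarrow> real) \<Rightarrow> 'a \<Rightarrow> bool" where
  "has_gateaux_derivative N b L y \<longleftrightarrow>
     \<bar>b y\<bar> \<noteq> \<infinity> \<and> L \<in> dual_space N \<and>
     (\<forall>v. ((\<lambda>t::real. (b (y + t *\<^sub>R v) - b y) / ereal t) \<longlongrightarrow> ereal (L v)) (at 0))"

definition gateaux_derivative ::
  "('a::real_vector \<Rightarrow> real) \<Rightarrow> ('a \<Rightarrow> ereal) \<Rightarrow> 'a \<Rightarrow> 'a \<Rightarrow> real" where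
  "gateaux_derivative N b y = (THE L. has_gateaux_derivative N b L y)"

definition divergence ::
  "('a::real_vector \<Rightarrow> real) \<Rightarrow> ('a \<Rightarrow> ereal) \<Rightarrow> 'a set \<Rightarrow> 'a \<Rightarrow> 'a \<Rightarrow> ereal" where
  "divergence N b U x y =
     (if x \<in> dom_of b \<and> y \<in> U then b x - b y - ereal (gateaux_derivative N b y (x - y)) else \<infinity>)"

definition bregman_function ::
  "('a::real_vector \<Rightarrow> real) \<Rightarrow> ('a \<Rightarrow> ereal) \<Rightarrow> 'a set \<Rightarrow> bool" where
  "bregman_function N b U \<longleftrightarrow>
     proper_values b \<and>
     \<comment> \<open>(i)\<close>
     U = norm_topology N interior_of dom_of b \<and> U \<noteq> {} \<and>
     (\<forall>y\<in>U. \<exists>L. has_gateaux_derivative N b L y) \<and>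
     \<comment> \<open>(ii)\<close>
     econvex b \<and> lower_semicontinuous N b \<and> estrictly_convex_on (dom_of b) b \<and>
     \<comment> \<open>(iii)\<close>
     (\<forall>\<gamma>::real. \<forall>x\<in>dom_of b. norm_bounded N {y \<in> U. divergence N b U x y \<le> ereal \<gamma>}) \<and>
     \<comment> \<open>(iv)\<close>
     (\<forall>x\<in>dom_of b. \<forall>y::nat \<Rightarrow> 'a. (\<forall>i. y i \<in> U) \<and> (\<lambda>i. N (x - y i)) \<longlonglongrightarrow> 0
        \<longrightarrow> (\<lambda>i. divergence N b U x (y i)) \<longlonglongrightarrow> 0) \<and>
     \<comment> \<open>(v)\<close>
     (\<forall>(x::nat \<Rightarrow> 'a) (y::nat \<Rightarrow> 'a). \<forall>z\<in>dom_of b.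
        (\<forall>i. x i \<in> dom_of b) \<and> norm_bounded N (range x) \<and> (\<forall>i. y i \<in> U) \<and>
        (\<lambda>i. divergence N b U (x i) (y i)) \<longlonglongrightarrow> 0 \<and> (\<lambda>i. N (y i - z)) \<longlonglongrightarrow> 0
        \<longrightarrow> (\<lambda>i. N (x i - z)) \<longlonglongrightarrow> 0)"

definition limiting_difference_property ::
  "('a::real_vector \<Rightarrow> real) \<Rightarrow> ('a \<Rightarrow> ereal) \<Rightarrow> 'a set \<Rightarrow> bool" where
  "limiting_difference_property N b U \<longleftrightarrow>
     (\<forall>x\<in>dom_of b. \<forall>y::nat \<Rightarrow> 'a. \<forall>z\<in>U. (\<forall>i. y i \<in> U) \<and> weakly_converges N y z
        \<longrightarrow> (\<lambda>i. divergence N b U x (y i) - divergence N b U z (y i))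
              \<longlonglongrightarrow> divergence N b U x z)"

definition sequentially_consistent ::
  "('a::real_vector \<Rightarrow> real) \<Rightarrow> ('a \<Rightarrow> ereal) \<Rightarrow> 'a set \<Rightarrow> bool" where
  "sequentially_consistent N b U \<longleftrightarrow>
     (\<forall>(x::nat \<Rightarrow> 'a) (y::nat \<Rightarrow> 'a).
        (\<forall>i. x i \<in> dom_of b) \<and> (\<forall>i. y i \<in> U) \<and> norm_bounded N (range y) \<and>
        (\<lambda>i. divergence N b U (x i) (y i)) \<longlonglongrightarrow> 0
        \<longrightarrow> (\<lambda>i. N (x i - y i)) \<longlonglongrightarrow> 0)"


subsection \<open>The negative Havrda-Charvat-Tsallis entropy\<close>

definition pos_orthant :: "(real ^ 'n::finite) set" where
  "pos_orthant = {x. \<forall>k. 0 < x $ k}"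

definition nonneg_orthant :: "(real ^ 'n::finite) set" where
  "nonneg_orthant = {x. \<forall>k. 0 \<le> x $ k}"

text \<open>Only used for \<open>q \<notin> {0, 1}\<close>. Note that \<open>0 powr q = 0\<close>, as required for \<open>q > 0\<close>.\<close>

definition tsallis :: "real \<Rightarrow> real ^ 'n::finite \<Rightarrow> ereal" where
  "tsallis q x =
     (if q > 0
      then (if x \<in> nonneg_orthant then ereal (1 / (q - 1) * (\<Sum>k\<in>UNIV. x $ k powr q - 1)) else \<infinity>)
      else (if x \<in> pos_orthant then ereal (1 / (1 - q) * (\<Sum>k\<in>UNIV. x $ k powr q - 1)) else \<infinity>))"

end

theory Submission
  imports Defs "HOL-Real_Asymp.Real_Asymp"
begin

text \<open>
  The entropy is a sum of copies, one per coordinate, of a single function \<open>\<phi>\<close> of one real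
  variable, and the sign in front of it is chosen so that \<open>\<phi>''(t) = \<bar>q\<bar> t powr (q - 2)\<close> for both signs
  of \<open>q\<close>. Everything rests on this formula.

  Convexity, parts (a) and (b). If \<open>\<phi>'' \<ge> c\<close> strictly between \<open>s\<close> and \<open>t\<close>, then the convexity gap
  \<open>\<alpha> \<phi>(s) + (1 - \<alpha>) \<phi>(t) - \<phi>(\<alpha> s + (1 - \<alpha>) t)\<close> is at least \<open>\<alpha> (1 - \<alpha>) (c / 2) (s - t)\<^sup>2\<close>
  (\<open>entropy_term_gap\<close>). This concerns a single pair of points, so the constant may
  depend on the pair, and only the curvature strictly between them enters, so coordinates may vanish.
  Summation gives a gap of \<open>\<alpha> (1 - \<alpha>) (c / 2) (norm (x - y))\<^sup>2\<close>, and the Euclidean norm dominates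
  \<open>c2\<close> times the given one. What remains is to bound \<open>u powr (q - 2)\<close> from below: by an upper bound on the
  coordinates when \<open>q < 2\<close>, which the max norm provides, and by a positive lower bound on them when
  \<open>q > 2\<close>, which the distance to the boundary provides. In (b) the upper bound is proportional to
  \<open>N (x - y)\<close>, and this turns the quadratic gauge into one of order \<open>q\<close>.

  Failure of convexity, part (c). On the diagonal the gap is explicit (\<open>diagonal_gauge_bound\<close>). Between
  \<open>s\<close> and \<open>2 s\<close> it is a multiple of \<open>s powr q\<close>, which cannot dominate a multiple of \<open>s\<^sup>2\<close> for all
  \<open>s > 0\<close>. For \<open>q = 1/2\<close> the gap between \<open>s\<close> and \<open>s + 1\<close> tends to 0 although the distance is constant.

  Bregman properties, part (d). The divergence is the sum of the one-variable divergences \<open>d(s, t)\<close>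
  of \<open>\<phi>\<close>, which are all nonnegative, so bounds and limits can be treated coordinatewise. The boundary is
  delicate, since \<open>\<phi>'\<close> may blow up at 0. Continuity in the second
  argument follows from \<open>term_divergence_formula\<close>. For sequential consistency, \<open>d(s, t)\<close> is bounded
  below by twice the midpoint gap of \<open>\<phi>\<close>, an expression free of \<open>\<phi>'\<close> that is continuous and positive
  up to the boundary, so compactness applies (\<open>term_divergence_uniform_lower_bound\<close>).
  For \<open>q < 0\<close> the divergence stays bounded as its second argument goes to infinity along the
  diagonal, which contradicts the boundedness of the level sets.
\<close>

section \<open>The one-variable entropy\<close>

text \<open>
  The factor \<open>sgn q / (q - 1)\<close> merges the two prefactors \<open>1 / (q - 1)\<close> for \<open>q > 0\<close> and
  \<open>1 / (1 - q)\<close> for \<open>q < 0\<close>.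
\<close>

definition entropy_term :: "real \<Rightarrow> real \<Rightarrow> real" where
  "entropy_term q t = sgn q / (q - 1) * (t powr q - 1)"

definition entropy_slope :: "real \<Rightarrow> real \<Rightarrow> real" where
  "entropy_slope q t = \<bar>q\<bar> / (q - 1) * t powr (q - 1)"

definition entropy_dom :: "real \<Rightarrow> real set" where
  "entropy_dom q = (if q > 0 then {0..} else {0<..})"

text \<open>
  Applying the mean value theorem on both sides of the intermediate point expresses the convexity gap
  through an increment of the derivative. Only continuity is required at the endpoints, where the
  entropy need not be differentiable.
\<close>

lemma gap_mean_value:
  fixes f f' :: "real \<Rightarrow> real"
  assumes "s < t" and cont: "continuous_on {s..t} f"
    and deriv: "\<And>u. s < u \<Longrightarrow> u < t \<Longrightarrow> (f has_real_derivative f' u) (at u)"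
    and \<alpha>: "0 < \<alpha>" "\<alpha> < 1"
  obtains u v where "s < u" "u < v" "v < t"
    "\<alpha> * f s + (1 - \<alpha>) * f t - f (\<alpha> * s + (1 - \<alpha>) * t) = \<alpha> * (1 - \<alpha>) * (t - s) * (f' v - f' u)"
proof -
  define m where "m = \<alpha> * s + (1 - \<alpha>) * t"
  have ms: "m - s = (1 - \<alpha>) * (t - s)" and tm: "t - m = \<alpha> * (t - s)"
    by (simp_all add: m_def algebra_simps)
  have "m - s > 0" "t - m > 0"
    unfolding ms tm using assms by auto
  then have "s < m" "m < t" by auto
  obtain u where u: "s < u" "u < m" "f m - f s = (m - s) * f' u"
  proof -
    have "continuous_on {s..m} f"
      using cont by (rule continuous_on_subset) (use \<open>m < t\<close> in auto)
    moreover have "f differentiable (at x)" if "s < x" "x < m" for x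
      using deriv[of x] that \<open>m < t\<close> real_differentiable_def by fastforce
    ultimately obtain l z where "s < z" "z < m" "DERIV f z :> l" "f m - f s = (m - s) * l"
      using MVT[OF \<open>s < m\<close>] by blast
    then show ?thesis
      using that[of z] DERIV_unique[of f l z "f' z"] deriv[of z] \<open>m < t\<close> by auto
  qed
  obtain v where v: "m < v" "v < t" "f t - f m = (t - m) * f' v"
  proof -
    have "continuous_on {m..t} f"
      using cont by (rule continuous_on_subset) (use \<open>s < m\<close> in auto)
    moreover have "f differentiable (at x)" if "m < x" "x < t" for x
      using deriv[of x] that \<open>s < m\<close> real_differentiable_def by fastforce
    ultimately obtain l z where "m < z" "z < t" "DERIV f z :> l" "f t - f m = (t - m) * l"
      using MVT[OF \<open>m < t\<close>] by blast
    then show ?thesis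
      using that[of z] DERIV_unique[of f l z "f' z"] deriv[of z] \<open>s < m\<close> by auto
  qed
  have "\<alpha> * f s + (1 - \<alpha>) * f t - f m = (1 - \<alpha>) * (f t - f m) - \<alpha> * (f m - f s)"
    by (simp add: algebra_simps)
  also have "\<dots> = \<alpha> * (1 - \<alpha>) * (t - s) * (f' v - f' u)"
    unfolding u(3) v(3) ms tm by (simp add: algebra_simps)
  finally show ?thesis
    using that[of u v] u v by (simp add: m_def)
qed

lemma entropy_term_deriv:
  assumes "t > 0"
  shows "(entropy_term q has_real_derivative entropy_slope q t) (at t)"
proof -
  have "((\<lambda>t. sgn q / (q - 1) * (t powr q - 1)) has_real_derivative
          sgn q / (q - 1) * (q * t powr (q - 1))) (at t)"
    using assms by (intro DERIV_cmult) (auto intro!: derivative_eq_intros)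
  moreover have "sgn q / (q - 1) * (q * t powr (q - 1)) = entropy_slope q t"
    by (simp add: entropy_slope_def abs_sgn mult_ac)
  ultimately show ?thesis
    by (simp add: entropy_term_def[abs_def])
qed

lemma entropy_slope_deriv:
  assumes "t > 0" "q \<noteq> 1"
  shows "(entropy_slope q has_real_derivative \<bar>q\<bar> * t powr (q - 2)) (at t)"
proof -
  have "((\<lambda>t. \<bar>q\<bar> / (q - 1) * t powr (q - 1)) has_real_derivative
          \<bar>q\<bar> / (q - 1) * ((q - 1) * t powr (q - 1 - 1))) (at t)"
    using assms by (auto intro!: derivative_eq_intros)
  then show ?thesis
    using assms by (simp add: entropy_slope_def[abs_def])
qed

lemma continuous_on_entropy_term: "continuous_on (entropy_dom q) (entropy_term q)"
  unfolding entropy_term_def[abs_def] entropy_dom_def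
  by (intro continuous_intros continuous_on_powr') auto

lemma entropy_slope_strict_mono:
  assumes "0 < u" "u < v" "q \<noteq> 0" "q \<noteq> 1"
  shows "entropy_slope q u < entropy_slope q v"
  using assms(2)
proof (rule DERIV_pos_imp_increasing)
  fix w assume "u \<le> w" "w \<le> v"
  then show "\<exists>y. (entropy_slope q has_real_derivative y) (at w) \<and> 0 < y"
    using entropy_slope_deriv[of w q] assms by (intro exI[of _ "\<bar>q\<bar> * w powr (q - 2)"]) auto
qed

lemma entropy_dom_nonneg: "t \<in> entropy_dom q \<Longrightarrow> 0 \<le> t"
  by (auto simp: entropy_dom_def split: if_splits)

lemma pos_in_entropy_dom: "0 < t \<Longrightarrow> t \<in> entropy_dom q"
  by (auto simp: entropy_dom_def)

lemma entropy_dom_segment: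
  assumes "s \<in> entropy_dom q" "t \<in> entropy_dom q"
  shows "{s..t} \<subseteq> entropy_dom q"
  using assms by (auto simp: entropy_dom_def split: if_splits)

lemma convex_entropy_dom: "convex (entropy_dom q)"
  by (simp add: entropy_dom_def)

text \<open>
  Subtracting \<open>c / 2 * u\<^sup>2\<close> leaves a function with nondecreasing derivative, whose gap is nonnegative;
  the gap of the quadratic part is computed exactly.
\<close>

lemma entropy_term_gap:
  assumes q: "q \<noteq> 0" "q \<noteq> 1" and st: "s \<in> entropy_dom q" "t \<in> entropy_dom q"
    and c: "\<And>u. min s t < u \<Longrightarrow> u < max s t \<Longrightarrow> c \<le> \<bar>q\<bar> * u powr (q - 2)"
    and \<alpha>: "0 < \<alpha>" "\<alpha> < 1"
  shows "entropy_term q (\<alpha> * s + (1 - \<alpha>) * t) + \<alpha> * (1 - \<alpha>) * (c / 2 * (s - t)\<^sup>2)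
           \<le> \<alpha> * entropy_term q s + (1 - \<alpha>) * entropy_term q t"
  using st c \<alpha>
proof (induction s t arbitrary: \<alpha> rule: linorder_wlog)
  case (le s t)
  show ?case
  proof (cases "s = t")
    case True
    then show ?thesis by (simp add: algebra_simps)
  next
    case False
    with le have "s < t" by simp
    define g where "g = (\<lambda>u. entropy_term q u - c / 2 * u\<^sup>2)"
    define g' where "g' = (\<lambda>u. entropy_slope q u - c * u)"
    have s0: "0 \<le> s" using le entropy_dom_nonneg by blast
    have cont: "continuous_on {s..t} g"
      unfolding g_def
      by (intro continuous_intros continuous_on_subset[OF continuous_on_entropy_term[of q]]
            entropy_dom_segment le)
    have deriv: "(g has_real_derivative g' u) (at u)" if "s < u" "u < t" for u
      unfolding g_def g'_def using that s0
      by (auto intro!: derivative_eq_intros entropy_term_deriv)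
    obtain u v where uv: "s < u" "u < v" "v < t"
      "\<alpha> * g s + (1 - \<alpha>) * g t - g (\<alpha> * s + (1 - \<alpha>) * t) = \<alpha> * (1 - \<alpha>) * (t - s) * (g' v - g' u)"
      using gap_mean_value[OF \<open>s < t\<close> cont deriv \<open>0 < \<alpha>\<close> \<open>\<alpha> < 1\<close>] by metis
    have "g' u \<le> g' v"
    proof (rule DERIV_nonneg_imp_nondecreasing[where f = g' and a = u and b = v])
      fix w assume "u \<le> w" "w \<le> v"
      then have "s < w" "w < t" using uv by auto
      moreover have "(g' has_real_derivative \<bar>q\<bar> * w powr (q - 2) - c) (at w)"
        unfolding g'_def using \<open>s < w\<close> s0 q
        by (auto intro!: derivative_eq_intros entropy_slope_deriv)
      ultimately show "\<exists>y. (g' has_real_derivative y) (at w) \<and> 0 \<le> y"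
        using le(4)[of w] \<open>s < t\<close> by (intro exI[of _ "\<bar>q\<bar> * w powr (q - 2) - c"]) auto
    qed (use uv in simp)
    then have "0 \<le> \<alpha> * (1 - \<alpha>) * (t - s) * (g' v - g' u)"
      using le \<open>s < t\<close> by (intro mult_nonneg_nonneg) auto
    then have "g (\<alpha> * s + (1 - \<alpha>) * t) \<le> \<alpha> * g s + (1 - \<alpha>) * g t"
      using uv(4) by linarith
    moreover have "c / 2 * (\<alpha> * s + (1 - \<alpha>) * t)\<^sup>2 + \<alpha> * (1 - \<alpha>) * (c / 2 * (s - t)\<^sup>2)
        = \<alpha> * (c / 2 * s\<^sup>2) + (1 - \<alpha>) * (c / 2 * t\<^sup>2)"
      by (simp add: power2_eq_square field_simps)
    ultimately show ?thesis
      unfolding g_def right_diff_distrib by linarith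
  qed
next
  case (sym s t)
  have "entropy_term q ((1 - \<alpha>) * t + (1 - (1 - \<alpha>)) * s)
      + (1 - \<alpha>) * (1 - (1 - \<alpha>)) * (c / 2 * (t - s)\<^sup>2)
    \<le> (1 - \<alpha>) * entropy_term q t + (1 - (1 - \<alpha>)) * entropy_term q s"
    using sym.prems by (intro sym.IH) (auto simp: min.commute max.commute)
  then show ?case
    by (simp add: power2_commute[of t s] mult.commute[of "1 - \<alpha>" \<alpha>] add.commute)
qed

text \<open>
  This does not follow from \<open>entropy_term_gap\<close>: for \<open>q > 2\<close> and an endpoint 0 the second
  derivative has infimum 0 on the segment.
\<close>

lemma entropy_term_strictly_convex:
  assumes q: "q \<noteq> 0" "q \<noteq> 1" and st: "s \<in> entropy_dom q" "t \<in> entropy_dom q" "s \<noteq> t"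
    and \<alpha>: "0 < \<alpha>" "\<alpha> < 1"
  shows "entropy_term q (\<alpha> * s + (1 - \<alpha>) * t) < \<alpha> * entropy_term q s + (1 - \<alpha>) * entropy_term q t"
  using st \<alpha>
proof (induction s t arbitrary: \<alpha> rule: linorder_wlog)
  case (le s t)
  then have "s < t" by simp
  have s0: "0 \<le> s" using le entropy_dom_nonneg by blast
  have cont: "continuous_on {s..t} (entropy_term q)"
    by (intro continuous_on_subset[OF continuous_on_entropy_term[of q]] entropy_dom_segment le)
  have deriv: "(entropy_term q has_real_derivative entropy_slope q u) (at u)" if "s < u" "u < t" for u
    using that s0 by (intro entropy_term_deriv) auto
  obtain u v where uv: "s < u" "u < v" "v < t"
    "\<alpha> * entropy_term q s + (1 - \<alpha>) * entropy_term q t - entropy_term q (\<alpha> * s + (1 - \<alpha>) * t)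
       = \<alpha> * (1 - \<alpha>) * (t - s) * (entropy_slope q v - entropy_slope q u)"
    using gap_mean_value[OF \<open>s < t\<close> cont deriv \<open>0 < \<alpha>\<close> \<open>\<alpha> < 1\<close>] by metis
  have "entropy_slope q u < entropy_slope q v"
    using uv s0 q by (intro entropy_slope_strict_mono) auto
  then have "0 < \<alpha> * (1 - \<alpha>) * (t - s) * (entropy_slope q v - entropy_slope q u)"
    using le \<open>s < t\<close> by (intro mult_pos_pos) auto
  then show ?case using uv(4) by linarith
next
  case (sym s t)
  have "entropy_term q ((1 - \<alpha>) * t + (1 - (1 - \<alpha>)) * s)
    < (1 - \<alpha>) * entropy_term q t + (1 - (1 - \<alpha>)) * entropy_term q s"
    using sym.prems by (intro sym.IH) auto
  then show ?case by (simp add: add.commute)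
qed

lemma entropy_term_convex:
  assumes "q \<noteq> 0" "q \<noteq> 1" "s \<in> entropy_dom q" "t \<in> entropy_dom q" "0 < \<alpha>" "\<alpha> < 1"
  shows "entropy_term q (\<alpha> * s + (1 - \<alpha>) * t) \<le> \<alpha> * entropy_term q s + (1 - \<alpha>) * entropy_term q t"
  using entropy_term_gap[of q s t 0 \<alpha>] assms by simp

lemma entropy_midpoint_strict:
  assumes "q \<noteq> 0" "q \<noteq> 1" "s \<in> entropy_dom q" "t \<in> entropy_dom q" "s \<noteq> t"
  shows "0 < entropy_term q s + entropy_term q t - 2 * entropy_term q ((s + t) / 2)"
  using entropy_term_strictly_convex[of q s t "1/2"] assms by (simp add: field_simps)

section \<open>The one-variable divergence\<close>

definition term_divergence :: "real \<Rightarrow> real \<Rightarrow> real \<Rightarrow> real" where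
  "term_divergence q s t = entropy_term q s - entropy_term q t - entropy_slope q t * (s - t)"

lemma term_divergence_nonneg:
  assumes q: "q \<noteq> 0" "q \<noteq> 1" and s: "s \<in> entropy_dom q" and t: "t > 0"
  shows "0 \<le> term_divergence q s t"
proof -
  have "convex_on (entropy_dom q) (entropy_term q)"
  proof (intro convex_onI convex_entropy_dom)
    fix \<alpha> x y :: real
    assume "0 < \<alpha>" "\<alpha> < 1" "x \<in> entropy_dom q" "y \<in> entropy_dom q"
    then show "entropy_term q ((1 - \<alpha>) *\<^sub>R x + \<alpha> *\<^sub>R y)
        \<le> (1 - \<alpha>) * entropy_term q x + \<alpha> * entropy_term q y"
      using entropy_term_convex[OF q, of x y "1 - \<alpha>"] by simp
  qed
  moreover have "t \<in> interior (entropy_dom q)"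
    using t interior_maximal[of "{0<..}" "entropy_dom q"] by (auto simp: entropy_dom_def)
  ultimately have "entropy_slope q t * (s - t) \<le> entropy_term q s - entropy_term q t"
    using s entropy_term_deriv[OF t, of q]
    by (intro convex_on_imp_above_tangent[of "entropy_dom q"])
       (auto simp: convex_connected convex_entropy_dom intro: has_field_derivative_at_within)
  then show ?thesis by (simp add: term_divergence_def)
qed

text \<open>
  The tangent at \<open>t\<close> lies below the graph at the midpoint. The resulting lower bound does not involve the
  slope at \<open>t\<close> and therefore remains meaningful, and positive, as \<open>t\<close> tends to 0.
\<close>

lemma term_divergence_ge_midpoint_gap:
  assumes q: "q \<noteq> 0" "q \<noteq> 1" and s: "s \<in> entropy_dom q" and t: "t > 0"
  shows "entropy_term q s + entropy_term q t - 2 * entropy_term q ((s + t) / 2) \<le> term_divergence q s t"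
proof -
  have "0 \<le> term_divergence q ((s + t) / 2) t"
    using assms entropy_dom_nonneg[OF s] by (intro term_divergence_nonneg pos_in_entropy_dom) auto
  moreover have "(s + t) / 2 - t = (s - t) / 2" by (simp add: field_simps)
  ultimately show ?thesis
    by (simp add: term_divergence_def)
qed

lemma term_divergence_pos:
  assumes "q \<noteq> 0" "q \<noteq> 1" "s \<in> entropy_dom q" "t > 0" "s \<noteq> t"
  shows "0 < term_divergence q s t"
  using entropy_midpoint_strict[of q s t] term_divergence_ge_midpoint_gap[of q s t]
    pos_in_entropy_dom[of t q] assms by simp

text \<open>
  The divergence is convex in its first argument and vanishes at \<open>s = t\<close>. Estimates at a fixed distance
  from \<open>t\<close> thus propagate to all larger distances.
\<close>

lemma term_divergence_scale:
  assumes q: "q \<noteq> 0" "q \<noteq> 1" and s: "s \<in> entropy_dom q" and t: "t > 0"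
    and \<alpha>: "0 < \<alpha>" "\<alpha> \<le> 1"
  shows "term_divergence q (\<alpha> * s + (1 - \<alpha>) * t) t \<le> \<alpha> * term_divergence q s t"
proof (cases "\<alpha> = 1")
  case False
  with \<alpha> have "entropy_term q (\<alpha> * s + (1 - \<alpha>) * t) \<le> \<alpha> * entropy_term q s + (1 - \<alpha>) * entropy_term q t"
    using assms pos_in_entropy_dom[OF t, of q] by (intro entropy_term_convex) auto
  then show ?thesis by (simp add: term_divergence_def algebra_simps)
qed simp

section \<open>An arbitrary norm on Euclidean space\<close>

locale comparable_norm =
  fixes N :: "real ^ 'n::finite \<Rightarrow> real" and c2 cinf :: real
  assumes is_norm: "is_norm N"
    and c2_pos: "c2 > 0" and cinf_pos: "cinf > 0"
    and le_norm: "\<And>v. c2 * N v \<le> norm v"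
    and infnorm_le: "\<And>v. infnorm v \<le> cinf * N v"
begin

lemma N_nonneg: "0 \<le> N x" and N_eq_0_iff: "N x = 0 \<longleftrightarrow> x = 0"
  and N_scale: "N (a *\<^sub>R x) = \<bar>a\<bar> * N x" and N_triangle: "N (x + y) \<le> N x + N y"
  using is_norm by (auto simp: is_norm_def)

lemma N_commute: "N (x - y) = N (y - x)"
  using N_scale[of "-1" "x - y"] by simp

lemma N_pos: "x \<noteq> 0 \<Longrightarrow> 0 < N x"
  using N_nonneg[of x] N_eq_0_iff[of x] by simp

lemma N_vec_1_pos: "0 < N (vec 1)"
  by (intro N_pos) (simp add: vec_eq_iff)

lemma N_reverse_triangle: "N y - N x \<le> N (x - y)"
  using N_triangle[of x "y - x"] N_commute[of x y] by simp

lemma component_le: "\<bar>x $ k\<bar> \<le> cinf * N x"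
  using component_le_infnorm_cart[of x k] infnorm_le[of x] by linarith

lemma N_le: "N x \<le> norm x / c2"
  using le_norm[of x] c2_pos by (simp add: field_simps)

lemma norm_le: "norm x \<le> real CARD('n) * cinf * N x"
proof -
  have "norm x \<le> (\<Sum>k\<in>UNIV. \<bar>x $ k\<bar>)" by (rule norm_le_l1_cart)
  also have "\<dots> \<le> (\<Sum>k\<in>(UNIV :: 'n set). cinf * N x)" by (intro sum_mono component_le)
  finally show ?thesis by simp
qed

lemma card_cinf_pos: "0 < real CARD('n) * cinf"
  using cinf_pos by simp

lemma Metric_space_N: "Metric_space UNIV (\<lambda>x y. N (x - y))"
proof
  fix x y z
  show "N (x - z) \<le> N (x - y) + N (y - z)"
    using N_triangle[of "x - y" "y - z"] by simp
qed (auto simp: N_nonneg N_eq_0_iff N_commute)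

lemma norm_topology_eq: "norm_topology N = euclidean"
proof -
  interpret Metric_space UNIV "\<lambda>x y. N (x - y)" by (rule Metric_space_N)
  have "(\<exists>r>0. mball x r \<subseteq> S) \<longleftrightarrow> (\<exists>r>0. ball x r \<subseteq> S)" for x :: "real ^ 'n" and S
  proof (intro iffI; elim exE conjE)
    fix r :: real assume r: "r > 0" "mball x r \<subseteq> S"
    have "ball x (c2 * r) \<subseteq> mball x r"
    proof
      fix y assume "y \<in> ball x (c2 * r)"
      then have "c2 * N (x - y) < c2 * r"
        using le_norm[of "x - y"] by (simp add: dist_norm)
      then show "y \<in> mball x r" using c2_pos by simp
    qed
    then show "\<exists>r>0. ball x r \<subseteq> S"
      using r c2_pos by (intro exI[of _ "c2 * r"]) auto
  next
    fix r :: real assume r: "r > 0" "ball x r \<subseteq> S"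
    have "mball x (r / (real CARD('n) * cinf)) \<subseteq> ball x r"
    proof
      fix y assume "y \<in> mball x (r / (real CARD('n) * cinf))"
      then have "real CARD('n) * cinf * N (x - y) < r"
        using card_cinf_pos by (simp add: field_simps)
      then show "y \<in> ball x r" using norm_le[of "x - y"] by (simp add: dist_norm)
    qed
    then show "\<exists>r>0. mball x r \<subseteq> S"
      using r card_cinf_pos
      by (intro exI[of _ "r / (real CARD('n) * cinf)"]) (auto intro: divide_pos_pos)
  qed
  then show ?thesis
    unfolding norm_topology_def topology_eq openin_mtopology
    by (auto simp: open_contains_ball simp flip: open_openin)
qed

lemma norm_bounded_iff: "norm_bounded N S \<longleftrightarrow> bounded S"
proof
  assume "norm_bounded N S"
  then obtain M where "\<forall>x\<in>S. N x \<le> M" by (auto simp: norm_bounded_def)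
  then have "\<forall>x\<in>S. norm x \<le> real CARD('n) * cinf * M"
    using norm_le card_cinf_pos by (meson mult_left_mono less_imp_le order_trans)
  then show "bounded S" by (auto simp: bounded_iff)
next
  assume "bounded S"
  then obtain M where "\<forall>x\<in>S. norm x \<le> M" by (auto simp: bounded_iff)
  then have "\<forall>x\<in>S. N x \<le> M / c2"
    using N_le c2_pos by (meson divide_right_mono less_imp_le order_trans)
  then show "norm_bounded N S" by (auto simp: norm_bounded_def)
qed

lemma N_tendsto_0_iff: "((\<lambda>i. N (f i)) \<longlongrightarrow> 0) F \<longleftrightarrow> (f \<longlongrightarrow> 0) F"
proof
  assume "((\<lambda>i. N (f i)) \<longlongrightarrow> 0) F"
  then have "((\<lambda>i. real CARD('n) * cinf * N (f i)) \<longlongrightarrow> 0) F"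
    by (intro tendsto_mult_right_zero)
  then show "(f \<longlongrightarrow> 0) F"
    by (rule Lim_null_comparison[rotated]) (intro always_eventually allI norm_le)
next
  assume "(f \<longlongrightarrow> 0) F"
  then have "((\<lambda>i. norm (f i) / c2) \<longlongrightarrow> 0) F"
    by (intro tendsto_divide_zero tendsto_norm_zero)
  then show "((\<lambda>i. N (f i)) \<longlongrightarrow> 0) F"
    by (rule Lim_null_comparison[rotated])
       (auto intro!: always_eventually simp: N_nonneg N_le)
qed

lemma N_diff_tendsto_0_iff: "((\<lambda>i. N (f i - l)) \<longlongrightarrow> 0) F \<longleftrightarrow> (f \<longlongrightarrow> l) F"
  unfolding N_tendsto_0_iff using LIM_zero_iff[of f l F] by simp

lemma weakly_converges_imp_tendsto:
  assumes "weakly_converges N y l"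
  shows "y \<longlonglongrightarrow> l"
proof (rule vec_tendstoI)
  fix k
  have "(\<lambda>x. x $ k) \<in> dual_space N"
    using component_le by (auto simp: dual_space_def intro: linearI)
  then show "(\<lambda>i. y i $ k) \<longlonglongrightarrow> l $ k"
    using assms by (auto simp: weakly_converges_def)
qed

end

section \<open>The entropy as a sum over coordinates\<close>

definition entropy :: "real \<Rightarrow> real ^ 'n::finite \<Rightarrow> real" where
  "entropy q x = (\<Sum>k\<in>UNIV. entropy_term q (x $ k))"

definition tsallis_dom :: "real \<Rightarrow> (real ^ 'n::finite) set" where
  "tsallis_dom q = {x. \<forall>k. x $ k \<in> entropy_dom q}"

lemma tsallis_eq: "q \<noteq> 0 \<Longrightarrow> tsallis q x = (if x \<in> tsallis_dom q then ereal (entropy q x) else \<infinity>)"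
proof -
  assume "q \<noteq> 0"
  moreover have "entropy q x = sgn q / (q - 1) * (\<Sum>k\<in>UNIV. x $ k powr q - 1)"
    by (simp only: entropy_def entropy_term_def sum_distrib_left)
  moreover have "sgn q / (q - 1) = (if q > 0 then 1 / (q - 1) else 1 / (1 - q))"
    using \<open>q \<noteq> 0\<close> minus_divide_divide[of 1 "1 - q"] by (auto simp: sgn_real_def)
  ultimately have "entropy q x =
      (if q > 0 then 1 / (q - 1) else 1 / (1 - q)) * (\<Sum>k\<in>UNIV. x $ k powr q - 1)"
    by (simp only:)
  then show ?thesis
    using \<open>q \<noteq> 0\<close>
    by (auto simp: tsallis_def tsallis_dom_def entropy_dom_def pos_orthant_def nonneg_orthant_def
        simp del: sum_subtractf)
qed

lemma dom_of_tsallis: "q \<noteq> 0 \<Longrightarrow> dom_of (tsallis q) = tsallis_dom q"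
  by (auto simp: dom_of_def tsallis_eq split: if_splits)

lemma tsallis_dom_pos: "q > 0 \<Longrightarrow> tsallis_dom q = nonneg_orthant"
  by (simp add: tsallis_dom_def entropy_dom_def nonneg_orthant_def)

lemma tsallis_dom_neg: "q < 0 \<Longrightarrow> tsallis_dom q = pos_orthant"
  by (simp add: tsallis_dom_def entropy_dom_def pos_orthant_def)

lemma pos_orthant_subset_dom: "pos_orthant \<subseteq> tsallis_dom q"
  by (auto simp: tsallis_dom_def pos_orthant_def pos_in_entropy_dom)

lemma tsallis_dom_component_nonneg: "x \<in> tsallis_dom q \<Longrightarrow> 0 \<le> x $ k"
  using entropy_dom_nonneg by (auto simp: tsallis_dom_def)

lemma tsallis_dom_between_pos:
  assumes "x \<in> tsallis_dom q" "y \<in> tsallis_dom q" "min (x $ k) (y $ k) < u"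
  shows "0 < u"
  using assms tsallis_dom_component_nonneg[of x q k] tsallis_dom_component_nonneg[of y q k] by linarith

lemma convex_tsallis_dom:
  assumes "x \<in> tsallis_dom q" "y \<in> tsallis_dom q" "0 \<le> \<alpha>" "\<alpha> \<le> 1"
  shows "\<alpha> *\<^sub>R x + (1 - \<alpha>) *\<^sub>R y \<in> tsallis_dom q"
  using assms convexD[OF convex_entropy_dom[of q], of _ _ \<alpha> "1 - \<alpha>"]
  by (auto simp: tsallis_dom_def)

lemma entropy_gap:
  fixes x y :: "real ^ 'n::finite"
  assumes q: "q \<noteq> 0" "q \<noteq> 1" and xy: "x \<in> tsallis_dom q" "y \<in> tsallis_dom q"
    and c: "\<And>k u. min (x $ k) (y $ k) < u \<Longrightarrow> u < max (x $ k) (y $ k) \<Longrightarrow> c \<le> \<bar>q\<bar> * u powr (q - 2)"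
    and \<alpha>: "0 < \<alpha>" "\<alpha> < 1"
  shows "entropy q (\<alpha> *\<^sub>R x + (1 - \<alpha>) *\<^sub>R y) + \<alpha> * (1 - \<alpha>) * (c / 2 * (norm (x - y))\<^sup>2)
           \<le> \<alpha> * entropy q x + (1 - \<alpha>) * entropy q y"
proof -
  have "(norm (x - y))\<^sup>2 = (\<Sum>k\<in>UNIV. (x $ k - y $ k)\<^sup>2)"
    by (simp only: power2_norm_eq_inner inner_vec_def) (simp add: power2_eq_square)
  then have "entropy q (\<alpha> *\<^sub>R x + (1 - \<alpha>) *\<^sub>R y) + \<alpha> * (1 - \<alpha>) * (c / 2 * (norm (x - y))\<^sup>2)
    = (\<Sum>k\<in>UNIV. entropy_term q (\<alpha> * x $ k + (1 - \<alpha>) * y $ k)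
         + \<alpha> * (1 - \<alpha>) * (c / 2 * (x $ k - y $ k)\<^sup>2))"
    by (simp add: entropy_def sum.distrib sum_distrib_left)
  also have "\<dots> \<le> (\<Sum>k\<in>UNIV. \<alpha> * entropy_term q (x $ k) + (1 - \<alpha>) * entropy_term q (y $ k))"
    using xy by (intro sum_mono entropy_term_gap q c \<alpha>) (auto simp: tsallis_dom_def)
  also have "\<dots> = \<alpha> * entropy q x + (1 - \<alpha>) * entropy q y"
    by (simp add: entropy_def sum.distrib sum_distrib_left)
  finally show ?thesis .
qed

lemma econvex_tsallis:
  fixes q :: real
  assumes q: "q \<noteq> 0" "q \<noteq> 1"
  shows "econvex (tsallis q :: real ^ 'n::finite \<Rightarrow> ereal)"
  unfolding econvex_def
proof (intro allI ballI)
  fix x y :: "real ^ 'n" and \<alpha> :: real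
  assume "\<alpha> \<in> {0<..<1}"
  then have \<alpha>: "0 < \<alpha>" "\<alpha> < 1" by auto
  show "tsallis q (\<alpha> *\<^sub>R x + (1 - \<alpha>) *\<^sub>R y) \<le> ereal \<alpha> * tsallis q x + ereal (1 - \<alpha>) * tsallis q y"
  proof (cases "x \<in> tsallis_dom q \<and> y \<in> tsallis_dom q")
    case True
    then show ?thesis
      using entropy_gap[OF q, of x y 0 \<alpha>] convex_tsallis_dom[of x q y \<alpha>] q \<alpha>
      by (simp add: tsallis_eq)
  next
    case False
    then show ?thesis using q \<alpha> by (auto simp: tsallis_eq)
  qed
qed

lemma uniformly_convex_relD:
  assumes "uniformly_convex_rel N b S1 S2 \<psi>" "\<alpha> \<in> {0<..<1}" "x \<in> S1" "y \<in> S2"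
  shows "b (\<alpha> *\<^sub>R x + (1 - \<alpha>) *\<^sub>R y) + ereal (\<alpha> * (1 - \<alpha>)) * \<psi> (N (x - y))
    \<le> ereal \<alpha> * b x + ereal (1 - \<alpha>) * b y"
  using assms by (simp only: uniformly_convex_rel_def)

section \<open>Relative uniform convexity\<close>

context comparable_norm
begin

text \<open>
  The curvature bound \<open>c\<close> may depend on the pair of points, so that gauges other than quadratic ones
  can be obtained from quadratic gaps.
\<close>

lemma uniformly_convex_relI:
  fixes \<psi> :: "real \<Rightarrow> real"
  assumes q: "q \<noteq> 0" "q \<noteq> 1"
    and S: "S1 \<noteq> {}" "S2 \<noteq> {}" "S1 \<subseteq> tsallis_dom q" "S2 \<subseteq> tsallis_dom q"
    and \<psi>: "0 \<le> \<psi> 0" "\<And>t. 0 < t \<Longrightarrow> 0 < \<psi> t"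
    and c: "\<And>x y. x \<in> S1 \<Longrightarrow> y \<in> S2 \<Longrightarrow> \<exists>c. \<psi> (N (x - y)) \<le> c / 2 * (norm (x - y))\<^sup>2 \<and>
      (\<forall>k u. min (x $ k) (y $ k) < u \<longrightarrow> u < max (x $ k) (y $ k) \<longrightarrow> c \<le> \<bar>q\<bar> * u powr (q - 2))"
  shows "uniformly_convex_rel N (tsallis q) S1 S2 (\<lambda>t. ereal (\<psi> t))"
  unfolding uniformly_convex_rel_def dom_of_tsallis[OF q(1)]
proof (intro conjI ballI)
  fix \<alpha> x y assume "\<alpha> \<in> {0<..<1::real}" and xy: "x \<in> S1" "y \<in> S2"
  then have \<alpha>: "0 < \<alpha>" "\<alpha> < 1" by auto
  obtain c where c: "\<psi> (N (x - y)) \<le> c / 2 * (norm (x - y))\<^sup>2"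
    "\<And>k u. min (x $ k) (y $ k) < u \<Longrightarrow> u < max (x $ k) (y $ k) \<Longrightarrow> c \<le> \<bar>q\<bar> * u powr (q - 2)"
    using c[OF xy] by blast
  have xy': "x \<in> tsallis_dom q" "y \<in> tsallis_dom q" using S xy by auto
  have "\<alpha> * (1 - \<alpha>) * \<psi> (N (x - y)) \<le> \<alpha> * (1 - \<alpha>) * (c / 2 * (norm (x - y))\<^sup>2)"
    using \<alpha> c(1) by (intro mult_left_mono) auto
  then have "entropy q (\<alpha> *\<^sub>R x + (1 - \<alpha>) *\<^sub>R y) + \<alpha> * (1 - \<alpha>) * \<psi> (N (x - y))
      \<le> \<alpha> * entropy q x + (1 - \<alpha>) * entropy q y"
    using entropy_gap[OF q xy' _ \<alpha>, of c] c(2) by force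
  then show "tsallis q (\<alpha> *\<^sub>R x + (1 - \<alpha>) *\<^sub>R y) + ereal (\<alpha> * (1 - \<alpha>)) * ereal (\<psi> (N (x - y)))
      \<le> ereal \<alpha> * tsallis q x + ereal (1 - \<alpha>) * tsallis q y"
    using xy' \<alpha> q convex_tsallis_dom[of x q y \<alpha>] by (simp add: tsallis_eq)
qed (use S \<psi> econvex_tsallis[OF q] in \<open>auto simp: order_le_less\<close>)

lemma strong_convexity_parameterI:
  assumes q: "q \<noteq> 0" "q \<noteq> 1" and S: "S \<noteq> {}" "S \<subseteq> tsallis_dom q" and "0 < c"
    and c: "\<And>x y k u. x \<in> S \<Longrightarrow> y \<in> S \<Longrightarrow> min (x $ k) (y $ k) < u \<Longrightarrow> u < max (x $ k) (y $ k)
              \<Longrightarrow> c \<le> \<bar>q\<bar> * u powr (q - 2)"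
  shows "strong_convexity_parameter N (tsallis q) S (c * c2\<^sup>2)"
  unfolding strong_convexity_parameter_def
proof (intro conjI uniformly_convex_relI exI allI impI)
  fix x y assume "x \<in> S" "y \<in> S"
  have "(c2 * N (x - y))\<^sup>2 \<le> (norm (x - y))\<^sup>2"
    using c2_pos N_nonneg le_norm by (intro power_mono) auto
  then show "1 / 2 * (c * c2\<^sup>2) * (N (x - y))\<^sup>2 \<le> c / 2 * (norm (x - y))\<^sup>2"
    using \<open>0 < c\<close> by (simp add: power_mult_distrib)
qed (use assms c2_pos in auto)

text \<open>
  The second derivative is decreasing, and \<open>cinf * M\<close> bounds all coordinates of points in \<open>S\<close>.
\<close>

lemma strong_convexity_parameter_bounded:
  assumes q: "q \<noteq> 0" "q \<noteq> 1" "q < 2" and S: "S \<noteq> {}" "S \<subseteq> tsallis_dom q"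
    and M: "0 < M" "\<And>x. x \<in> S \<Longrightarrow> N x \<le> M"
  shows "strong_convexity_parameter N (tsallis q) S (\<bar>q\<bar> * c2\<^sup>2 / (cinf * M) powr (2 - q))"
proof -
  have "strong_convexity_parameter N (tsallis q) S (\<bar>q\<bar> * (cinf * M) powr (q - 2) * c2\<^sup>2)"
  proof (rule strong_convexity_parameterI)
    fix x y k u assume xy: "x \<in> S" "y \<in> S" and u: "min (x $ k) (y $ k) < u" "u < max (x $ k) (y $ k)"
    have "0 < u"
      using xy S u tsallis_dom_between_pos by blast
    have "cinf * N z \<le> cinf * M" if "z \<in> S" for z
      using M that cinf_pos by simp
    then have "u \<le> cinf * M"
      using u component_le[of x k] component_le[of y k] xy by (smt (verit, best))
    then show "\<bar>q\<bar> * (cinf * M) powr (q - 2) \<le> \<bar>q\<bar> * u powr (q - 2)"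
      using \<open>0 < u\<close> q by (intro mult_left_mono powr_mono2') auto
  qed (use assms cinf_pos in auto)
  moreover have "(cinf * M) powr (q - 2) = 1 / (cinf * M) powr (2 - q)"
    using powr_minus_divide[of "cinf * M" "2 - q"] by simp
  ultimately show ?thesis by simp
qed

text \<open>
  Setting one coordinate of \<open>x \<in> V\<close> to 0 yields a boundary point, at a distance proportional to that
  coordinate. Hence all coordinates of points in \<open>V\<close> are at least some \<open>\<delta> > 0\<close>, also along the
  segments between them, where the second derivative is at least its value at \<open>\<delta>\<close>.
\<close>

lemma strongly_convex_away_from_boundary:
  assumes q: "q > 2" and V: "V \<noteq> {}" "V \<subseteq> pos_orthant"
    and d: "norm_setdist N V (norm_topology N frontier_of pos_orthant) > 0"
  shows "strongly_convex_on N (tsallis q) V"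
proof -
  let ?F = "norm_topology N frontier_of pos_orthant :: (real ^ 'n) set"
  define d where "d = norm_setdist N V ?F"
  have "0 < d" using assms by (simp add: d_def)
  define e where "e k = d / N (axis k 1)" for k
  have ax: "0 < N (axis k 1)" for k :: 'n
    by (intro N_pos) (simp add: axis_eq_0_iff)
  have comp: "e k \<le> x $ k" if "x \<in> V" for x k
  proof -
    have x: "\<forall>k. 0 < x $ k" using that V by (auto simp: pos_orthant_def)
    define y where "y = x - (x $ k) *\<^sub>R axis k 1"
    have "y \<in> closure pos_orthant"
      unfolding closure_sequential
    proof (intro exI conjI allI)
      fix i
      show "y + (x $ k / real (Suc i)) *\<^sub>R axis k 1 \<in> pos_orthant"
        using x by (auto simp: pos_orthant_def y_def axis_def)
      have "(\<lambda>i. x $ k * (1 / real (Suc i))) \<longlonglongrightarrow> 0"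
        by real_asymp
      then have "(\<lambda>i. y + (x $ k / real (Suc i)) *\<^sub>R axis k 1) \<longlonglongrightarrow> y + 0 *\<^sub>R axis k 1"
        by (intro tendsto_intros) simp
      then show "(\<lambda>i. y + (x $ k / real (Suc i)) *\<^sub>R axis k 1) \<longlonglongrightarrow> y" by simp
    qed
    moreover have "y \<notin> pos_orthant"
      by (auto simp: y_def pos_orthant_def intro!: exI[of _ k])
    ultimately have "y \<in> ?F"
      using interior_subset by (auto simp: norm_topology_eq frontier_def)
    then have "d \<le> N (x - y)"
      unfolding d_def norm_setdist_def using that
      by (intro cInf_lower bdd_belowI[of _ 0]) (auto simp: N_nonneg)
    also have "\<dots> = x $ k * N (axis k 1)"
      using x by (simp add: y_def N_scale order.strict_implies_order)
    finally show ?thesis using ax by (simp add: e_def field_simps)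
  qed
  define \<delta> where "\<delta> = Min (range e)"
  have "\<delta> > 0" using \<open>0 < d\<close> ax by (auto simp: \<delta>_def e_def)
  have \<delta>: "\<delta> \<le> x $ k" if "x \<in> V" for x k
    using order_trans[OF Min_le[of "range e" "e k"] comp[OF that]] by (simp add: \<delta>_def)
  have "strong_convexity_parameter N (tsallis q) V (\<bar>q\<bar> * \<delta> powr (q - 2) * c2\<^sup>2)"
  proof (rule strong_convexity_parameterI)
    fix x y k u assume "x \<in> V" "y \<in> V" and u: "min (x $ k) (y $ k) < u" "u < max (x $ k) (y $ k)"
    then have "\<delta> \<le> u" using \<delta>[of x k] \<delta>[of y k] by auto
    then show "\<bar>q\<bar> * \<delta> powr (q - 2) \<le> \<bar>q\<bar> * u powr (q - 2)"
      using \<open>\<delta> > 0\<close> q by (intro mult_left_mono powr_mono2) auto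
  qed (use assms \<open>\<delta> > 0\<close> pos_orthant_subset_dom[of q] in auto)
  then show ?thesis by (auto simp: strongly_convex_on_def)
qed

text \<open>
  If \<open>N y > 2 * N x\<close>, then \<open>N y < 2 * N (x - y)\<close>, so all coordinates on the segment are at
  most \<open>cinf * (2 * t)\<close> with \<open>t = N (x - y)\<close>. The curvature there is at least of order
  \<open>t powr (q - 2)\<close>, and multiplication by \<open>t\<^sup>2\<close> gives \<open>t powr q\<close>.
\<close>

lemma uniformly_convex_rel_far:
  assumes q: "q \<noteq> 0" "q \<noteq> 1" "q < 2" and x: "x \<in> tsallis_dom q"
  shows "uniformly_convex_rel N (tsallis q) {x} (pos_orthant \<inter> {w. N w > 2 * N x})
    (\<lambda>t. if t = 0 then 0
         else ereal (\<bar>q\<bar> * c2\<^sup>2 / (cinf powr (2 - q) * 2 powr (3 - q)) * t powr q))"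
proof -
  define C where "C = \<bar>q\<bar> * c2\<^sup>2 / (cinf powr (2 - q) * 2 powr (3 - q))"
  have "C > 0" using q c2_pos cinf_pos by (simp add: C_def)
  have "uniformly_convex_rel N (tsallis q) {x} (pos_orthant \<inter> {w. N w > 2 * N x})
    (\<lambda>t. ereal (if t = 0 then 0 else C * t powr q))"
  proof (rule uniformly_convex_relI)
    define e :: "real ^ 'n" where "e = vec 1"
    have "0 < N e" unfolding e_def by (rule N_vec_1_pos)
    moreover define s where "s = 2 * N x / N e + 1"
    ultimately have "0 < s" "2 * N x < s * N e"
      using N_nonneg[of x] by (simp_all add: add_nonneg_pos distrib_right)
    then have "s *\<^sub>R e \<in> pos_orthant \<inter> {w. N w > 2 * N x}"
      by (auto simp: N_scale pos_orthant_def e_def)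
    then show "pos_orthant \<inter> {w. N w > 2 * N x} \<noteq> {}" by blast
  next
    fix x' y assume "x' \<in> {x}" and "y \<in> pos_orthant \<inter> {w. N w > 2 * N x}"
    then have [simp]: "x' = x" and y: "\<forall>k. 0 < y $ k" "2 * N x < N y"
      by (auto simp: pos_orthant_def)
    have y': "y \<in> tsallis_dom q" using y pos_orthant_subset_dom[of q] by (auto simp: pos_orthant_def)
    define t where "t = N (x - y)"
    have "0 < N y" using y N_nonneg[of x] by linarith
    have t: "N y < 2 * t" using N_reverse_triangle[of y x] y by (simp add: t_def)
    then have "0 < t" using \<open>0 < N y\<close> by linarith
    define c where "c = \<bar>q\<bar> * (cinf * (2 * t)) powr (q - 2)"
    have "C * t powr q \<le> c / 2 * (norm (x - y))\<^sup>2"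
    proof -
      have "(c2 * t)\<^sup>2 \<le> (norm (x - y))\<^sup>2"
        unfolding t_def using c2_pos N_nonneg le_norm by (intro power_mono) auto
      then have "c / 2 * (c2 * t)\<^sup>2 \<le> c / 2 * (norm (x - y))\<^sup>2"
        by (intro mult_left_mono) (auto simp: c_def)
      moreover have "C * t powr q = c / 2 * (c2 * t)\<^sup>2"
      proof -
        have "t powr q = t powr (q - 2) * t\<^sup>2"
          using \<open>0 < t\<close> powr_add[of t "q - 2" 2] by simp
        moreover have "1 / (cinf powr (2 - q) * 2 powr (3 - q)) = cinf powr (q - 2) * 2 powr (q - 2) / 2"
        proof -
          have "2 powr (q - 2) / 2 = 2 powr (q - 3)"
            using powr_diff[of 2 "q - 2" 1] by simp
          also have "\<dots> = 1 / 2 powr (3 - q)"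
            using powr_minus_divide[of 2 "3 - q"] by simp
          finally have "2 powr (q - 2) / 2 = 1 / 2 powr (3 - q)" .
          moreover have "cinf powr (q - 2) = 1 / cinf powr (2 - q)"
            using powr_minus_divide[of cinf "2 - q"] by simp
          ultimately show ?thesis
            by (metis mult.right_neutral times_divide_eq_right times_divide_times_eq)
        qed
        moreover have "c = \<bar>q\<bar> * (cinf powr (q - 2) * 2 powr (q - 2) * t powr (q - 2))"
          using \<open>0 < t\<close> cinf_pos by (simp add: c_def powr_mult)
        moreover have "C = \<bar>q\<bar> * c2\<^sup>2 * (1 / (cinf powr (2 - q) * 2 powr (3 - q)))"
          by (simp add: C_def)
        ultimately show ?thesis
          by (simp only: power_mult_distrib) (simp add: mult_ac)
      qed
      ultimately show ?thesis by simp
    qed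
    moreover have "c \<le> \<bar>q\<bar> * u powr (q - 2)"
      if u: "min (x $ k) (y $ k) < u" "u < max (x $ k) (y $ k)" for k u
    proof -
      have "0 < u"
        using u x y' tsallis_dom_between_pos by blast
      have "cinf * N x \<le> cinf * (2 * t)" "cinf * N y \<le> cinf * (2 * t)"
        using t y \<open>0 < N y\<close> N_nonneg[of x] cinf_pos by (auto intro!: mult_left_mono)
      then have "u \<le> cinf * (2 * t)"
        using u component_le[of x k] component_le[of y k] by linarith
      then show ?thesis
        unfolding c_def using \<open>0 < u\<close> q by (intro mult_left_mono powr_mono2') auto
    qed
    ultimately show "\<exists>c. (if N (x' - y) = 0 then 0 else C * N (x' - y) powr q) \<le> c / 2 * (norm (x' - y))\<^sup>2 \<and>
      (\<forall>k u. min (x' $ k) (y $ k) < u \<longrightarrow> u < max (x' $ k) (y $ k) \<longrightarrow> c \<le> \<bar>q\<bar> * u powr (q - 2))"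
      using \<open>0 < t\<close> by (intro exI[of _ c]) (auto simp flip: t_def)
  qed (use q x \<open>C > 0\<close> pos_orthant_subset_dom[of q] in auto)
  moreover have eq: "(\<lambda>t. ereal (if t = 0 then 0 else C * t powr q)) = (\<lambda>t. if t = 0 then 0 else ereal (C * t powr q))"
    by (auto simp: zero_ereal_def)
  ultimately show ?thesis
    unfolding eq by (simp only: C_def)
qed

end

section \<open>Failure of uniform convexity\<close>

context comparable_norm
begin

text \<open>
  The gauge inequality with \<open>\<alpha> = 1/2\<close> at two points of the diagonal, solved for the gauge.
\<close>

lemma diagonal_gauge_bound:
  assumes q: "q \<noteq> 0" and uc: "uniformly_convex_rel N (tsallis q) pos_orthant pos_orthant \<psi>"
    and st: "0 < s" "0 < t"
  shows "\<psi> (\<bar>s - t\<bar> * N (vec 1))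
    \<le> ereal (2 * real CARD('n) * (entropy_term q s + entropy_term q t - 2 * entropy_term q ((s + t) / 2)))"
proof -
  have pos: "vec u \<in> (pos_orthant :: (real ^ 'n) set)" if "0 < u" for u :: real
    using that by (simp add: pos_orthant_def)
  have val: "tsallis q (vec u :: real ^ 'n) = ereal (real CARD('n) * entropy_term q u)" if "0 < u" for u
    using pos[OF that] pos_orthant_subset_dom[of q] q by (auto simp: tsallis_eq entropy_def)
  have mid: "(1/2) *\<^sub>R vec s + (1 - 1/2) *\<^sub>R vec t = (vec ((s + t) / 2) :: real ^ 'n)"
    by (simp add: vec_eq_iff field_simps)
  have "vec s - vec t = (s - t) *\<^sub>R (vec 1 :: real ^ 'n)"
    by (simp add: vec_eq_iff)
  then have dist: "N (vec s - vec t) = \<bar>s - t\<bar> * N (vec 1)"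
    by (simp only: N_scale)
  have half: "(1/2 :: real) \<in> {0<..<1}" by simp
  have "tsallis q ((1/2) *\<^sub>R vec s + (1 - 1/2) *\<^sub>R vec t :: real ^ 'n)
      + ereal (1/2 * (1 - 1/2)) * \<psi> (N (vec s - vec t))
      \<le> ereal (1/2) * tsallis q (vec s :: real ^ 'n) + ereal (1 - 1/2) * tsallis q (vec t :: real ^ 'n)"
    by (rule uniformly_convex_relD[OF uc half pos[OF st(1)] pos[OF st(2)]])
  moreover have "0 < (s + t) / 2" using st by simp
  ultimately have "ereal (real CARD('n) * entropy_term q ((s + t) / 2))
      + ereal (1/2 * (1 - 1/2)) * \<psi> (\<bar>s - t\<bar> * N (vec 1))
      \<le> ereal (1/2) * ereal (real CARD('n) * entropy_term q s)
        + ereal (1 - 1/2) * ereal (real CARD('n) * entropy_term q t)"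
    using st by (simp only: val mid dist)
  then show ?thesis
    by (cases "\<psi> (\<bar>s - t\<bar> * N (vec 1))") (simp_all add: algebra_simps)
qed

text \<open>
  By homogeneity the points \<open>s\<close> and \<open>2 s\<close> on the diagonal give \<open>A \<le> B * s powr (q - 2)\<close> with
  \<open>A > 0\<close>, and the right-hand side takes arbitrarily small values: near 0 for \<open>q > 2\<close>, near infinity for \<open>q < 2\<close>.
\<close>

lemma not_strongly_convex:
  assumes q: "q > 0" "q \<noteq> 2"
  shows "\<not> strongly_convex_on N (tsallis q) pos_orthant"
proof
  assume "strongly_convex_on N (tsallis q) pos_orthant"
  then obtain \<mu> where \<mu>: "0 < \<mu>"
    "uniformly_convex_rel N (tsallis q) pos_orthant pos_orthant (\<lambda>t. ereal (1/2 * \<mu> * t\<^sup>2))"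
    by (auto simp: strongly_convex_on_def strong_convexity_parameter_def)
  define A where "A = 1/2 * \<mu> * (N (vec 1))\<^sup>2"
  define B where "B = 2 * real CARD('n) * (sgn q / (q - 1) * (1 + 2 powr q - 2 * (3/2) powr q))"
  have "A > 0" using \<mu> N_vec_1_pos by (simp add: A_def)
  have bound: "A \<le> B * s powr (q - 2)" if "s > 0" for s
  proof -
    have "1/2 * \<mu> * (\<bar>s - 2 * s\<bar> * N (vec 1))\<^sup>2 \<le> 2 * real CARD('n) *
        (entropy_term q s + entropy_term q (2 * s) - 2 * entropy_term q ((s + 2 * s) / 2))"
      using diagonal_gauge_bound[OF _ \<mu>(2), of s "2 * s"] that q by simp
    also have "entropy_term q s + entropy_term q (2 * s) - 2 * entropy_term q ((s + 2 * s) / 2)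
      = sgn q / (q - 1) * (1 + 2 powr q - 2 * (3/2) powr q) * s powr q"
    proof -
      have "(s + 2 * s) / 2 = 3/2 * s" by simp
      then have "((s + 2 * s) / 2) powr q = (3/2) powr q * s powr q" "(2 * s) powr q = 2 powr q * s powr q"
        using that by (simp_all only: powr_mult)
      moreover have "K * (a - 1) + K * (p * a - 1) - 2 * (K * (r * a - 1)) = K * (1 + p - 2 * r) * a"
        for K a p r :: real
        by (simp add: algebra_simps)
      ultimately show ?thesis
        by (simp only: entropy_term_def)
    qed
    also have "1/2 * \<mu> * (\<bar>s - 2 * s\<bar> * N (vec 1))\<^sup>2 = A * s\<^sup>2"
      by (simp add: A_def power_mult_distrib)
    also have "s powr q = s powr (q - 2) * s\<^sup>2"
      using that powr_add[of s "q - 2" 2] by simp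
    finally have "A * s\<^sup>2 \<le> (B * s powr (q - 2)) * s\<^sup>2"
      by (simp only: B_def mult.assoc)
    then show ?thesis using that by (simp add: mult_le_cancel_right)
  qed
  \<comment> \<open>With \<open>s powr (q - 2) = r\<close> the bound becomes \<open>A \<le> B * r\<close>, and \<open>r\<close> is so small that \<open>B * r < A\<close>.\<close>
  define r where "r = A / (2 * (\<bar>B\<bar> + 1))"
  have "r > 0" using \<open>A > 0\<close> by (simp add: r_def)
  then have "A \<le> B * r"
    using bound[of "r powr (1 / (q - 2))"] q by (simp add: powr_powr)
  also have "\<dots> \<le> (\<bar>B\<bar> + 1) * r" using \<open>r > 0\<close> by (intro mult_right_mono) auto
  also have "\<dots> = A / 2" by (simp add: r_def field_simps)
  finally show False using \<open>A > 0\<close> by simp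
qed

text \<open>
  The points \<open>s\<close> and \<open>s + 1\<close> on the diagonal keep their distance, while the square root flattens.
\<close>

lemma not_uniformly_convex_half:
  "\<not> uniformly_convex_on N (tsallis (1/2)) pos_orthant"
proof
  let ?gap = "\<lambda>s::real. 2 * real CARD('n) * (entropy_term (1/2) s + entropy_term (1/2) (s + 1)
          - 2 * entropy_term (1/2) ((s + (s + 1)) / 2))"
  assume "uniformly_convex_on N (tsallis (1/2)) pos_orthant"
  then obtain \<psi> where \<psi>: "uniformly_convex_rel N (tsallis (1/2)) pos_orthant pos_orthant \<psi>"
    by (auto simp: uniformly_convex_on_def)
  then have "0 < \<psi> (N (vec 1))"
    using N_vec_1_pos by (simp add: uniformly_convex_rel_def)
  moreover have "\<psi> (N (vec 1)) \<le> ereal (?gap s)" if "s > 0" for s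
    using diagonal_gauge_bound[OF _ \<psi>, of s "s + 1"] that by simp
  then have "eventually (\<lambda>s. \<psi> (N (vec 1)) \<le> ereal (?gap s)) at_top"
    using eventually_gt_at_top[of 0] by (rule eventually_mono[rotated])
  moreover have "(?gap \<longlongrightarrow> 0) at_top"
    unfolding entropy_term_def by (rule tendsto_mult_right_zero) real_asymp
  then have "((\<lambda>s. ereal (?gap s)) \<longlongrightarrow> ereal 0) at_top" by simp
  ultimately show False
    using tendsto_lowerbound[of "\<lambda>s. ereal (?gap s)" "ereal 0" at_top "\<psi> (N (vec 1))"] 
    by (simp add: zero_ereal_def)
qed

end

section \<open>Topology of the orthants\<close>

lemma open_pos_orthant: "open (pos_orthant :: (real ^ 'n::finite) set)"
proof -
  have eq: "(pos_orthant :: (real ^ 'n) set) = (\<Inter>k. {x. 0 < x $ k})"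
    by (auto simp: pos_orthant_def)
  show ?thesis
    unfolding eq by (intro open_INT finite ballI open_Collect_less continuous_intros)
qed

lemma closed_nonneg_orthant: "closed (nonneg_orthant :: (real ^ 'n::finite) set)"
proof -
  have eq: "(nonneg_orthant :: (real ^ 'n) set) = (\<Inter>k. {x. 0 \<le> x $ k})"
    by (auto simp: nonneg_orthant_def)
  show ?thesis
    unfolding eq by (intro closed_INT ballI closed_Collect_le continuous_intros)
qed

lemma interior_tsallis_dom:
  "interior (tsallis_dom q :: (real ^ 'n::finite) set) = pos_orthant"
proof
  show "pos_orthant \<subseteq> interior (tsallis_dom q :: (real ^ 'n) set)"
    by (intro interior_maximal pos_orthant_subset_dom open_pos_orthant)
  show "interior (tsallis_dom q :: (real ^ 'n) set) \<subseteq> pos_orthant"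
  proof
    fix x :: "real ^ 'n" assume "x \<in> interior (tsallis_dom q)"
    then obtain e where e: "e > 0" "ball x e \<subseteq> tsallis_dom q"
      by (auto simp: mem_interior)
    have "0 < x $ k" for k
    proof -
      have "x - (e / 2) *\<^sub>R axis k 1 \<in> ball x e"
        using e by (simp add: dist_norm)
      then have "x - (e / 2) *\<^sub>R axis k 1 \<in> tsallis_dom q" using e by blast
      then have "0 \<le> (x - (e / 2) *\<^sub>R axis k 1) $ k"
        by (rule tsallis_dom_component_nonneg)
      then show ?thesis using e by simp
    qed
    then show "x \<in> pos_orthant" by (simp add: pos_orthant_def)
  qed
qed

lemma bounded_if_components_bounded:
  fixes S :: "(real ^ 'n::finite) set"
  assumes "\<And>k. \<exists>T. \<forall>x\<in>S. \<bar>x $ k\<bar> \<le> T"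
  shows "bounded S"
proof -
  obtain T where T: "\<And>k. \<forall>x\<in>S. \<bar>x $ k\<bar> \<le> T k" using assms by metis
  have "norm x \<le> (\<Sum>k\<in>UNIV. T k)" if "x \<in> S" for x
  proof -
    have "norm x \<le> (\<Sum>k\<in>UNIV. \<bar>x $ k\<bar>)" by (rule norm_le_l1_cart)
    also have "\<dots> \<le> (\<Sum>k\<in>UNIV. T k)" using T that by (intro sum_mono) auto
    finally show ?thesis .
  qed
  then show ?thesis by (auto simp: bounded_iff)
qed

section \<open>Derivative and divergence\<close>

definition entropy_gradient :: "real \<Rightarrow> real ^ 'n::finite \<Rightarrow> real ^ 'n \<Rightarrow> real" where
  "entropy_gradient q y v = (\<Sum>k\<in>UNIV. entropy_slope q (y $ k) * v $ k)"

definition entropy_divergence :: "real \<Rightarrow> real ^ 'n::finite \<Rightarrow> real ^ 'n \<Rightarrow> real" where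
  "entropy_divergence q x y = (\<Sum>k\<in>UNIV. term_divergence q (x $ k) (y $ k))"

lemma term_divergence_le_entropy_divergence:
  assumes q: "q \<noteq> 0" "q \<noteq> 1" and "x \<in> tsallis_dom q" "y \<in> pos_orthant"
  shows "term_divergence q (x $ k) (y $ k) \<le> entropy_divergence q x y"
  unfolding entropy_divergence_def using assms
  by (intro member_le_sum term_divergence_nonneg) (auto simp: tsallis_dom_def pos_orthant_def)

lemma entropy_has_directional_derivative:
  assumes "y \<in> pos_orthant"
  shows "((\<lambda>t. entropy q (y + t *\<^sub>R v)) has_real_derivative entropy_gradient q y v) (at 0)"
  unfolding entropy_def entropy_gradient_def
proof (rule DERIV_sum)
  fix k
  have "((\<lambda>t. y $ k + t * v $ k) has_real_derivative v $ k) (at 0)"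
    by (auto intro!: derivative_eq_intros)
  moreover have "(entropy_term q has_real_derivative entropy_slope q (y $ k)) (at (y $ k + 0 * v $ k))"
    using assms by (simp add: entropy_term_deriv pos_orthant_def)
  ultimately have "((\<lambda>t. entropy_term q (y $ k + t * v $ k)) has_real_derivative
      entropy_slope q (y $ k) * v $ k) (at 0)"
    using DERIV_chain2[of "entropy_term q" _ "\<lambda>t. y $ k + t * v $ k" 0] by blast
  then show "((\<lambda>t. entropy_term q ((y + t *\<^sub>R v) $ k)) has_real_derivative
      entropy_slope q (y $ k) * v $ k) (at 0)"
    by simp
qed

lemma has_gateaux_derivative_unique:
  assumes "has_gateaux_derivative N b L y" "has_gateaux_derivative N b L' y"
  shows "L = L'"
proof
  fix v
  have "((\<lambda>t::real. (b (y + t *\<^sub>R v) - b y) / ereal t) \<longlongrightarrow> ereal (L v)) (at 0)"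
    "((\<lambda>t::real. (b (y + t *\<^sub>R v) - b y) / ereal t) \<longlongrightarrow> ereal (L' v)) (at 0)"
    using assms by (auto simp: has_gateaux_derivative_def)
  then have "ereal (L v) = ereal (L' v)" by (rule tendsto_unique[rotated]) simp
  then show "L v = L' v" by simp
qed

context comparable_norm
begin

lemma tsallis_has_gateaux_derivative:
  assumes q: "q \<noteq> 0" and y: "y \<in> pos_orthant"
  shows "has_gateaux_derivative N (tsallis q) (entropy_gradient q y) y"
  unfolding has_gateaux_derivative_def
proof (intro conjI allI)
  have ydom: "y \<in> tsallis_dom q" using y pos_orthant_subset_dom by blast
  then show "\<bar>tsallis q y\<bar> \<noteq> \<infinity>" using q by (simp add: tsallis_eq)
  have "linear (entropy_gradient q y)"
    by (intro linearI) (auto simp: entropy_gradient_def sum.distrib sum_distrib_left algebra_simps)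
  moreover have "\<bar>entropy_gradient q y v\<bar> \<le> (\<Sum>k\<in>UNIV. \<bar>entropy_slope q (y $ k)\<bar> * cinf) * N v" for v
  proof -
    have "\<bar>entropy_gradient q y v\<bar> \<le> (\<Sum>k\<in>UNIV. \<bar>entropy_slope q (y $ k) * v $ k\<bar>)"
      unfolding entropy_gradient_def by (rule sum_abs)
    also have "\<dots> \<le> (\<Sum>k\<in>UNIV. \<bar>entropy_slope q (y $ k)\<bar> * (cinf * N v))"
      unfolding abs_mult by (intro sum_mono mult_left_mono component_le) auto
    finally show ?thesis by (simp add: sum_distrib_right mult.assoc)
  qed
  ultimately show "entropy_gradient q y \<in> dual_space N" by (auto simp: dual_space_def)
  fix v
  have "((\<lambda>t. (entropy q (y + t *\<^sub>R v) - entropy q y) / t) \<longlongrightarrow> entropy_gradient q y v) (at 0)"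
    using entropy_has_directional_derivative[OF y, of q v] by (simp add: DERIV_def)
  then have lim: "((\<lambda>t. ereal ((entropy q (y + t *\<^sub>R v) - entropy q y) / t))
      \<longlongrightarrow> ereal (entropy_gradient q y v)) (at 0)"
    by (rule tendsto_ereal)
  have "((\<lambda>t. y + t *\<^sub>R v) \<longlongrightarrow> y + 0 *\<^sub>R v) (at 0)"
    by (intro tendsto_intros)
  then have "eventually (\<lambda>t. y + t *\<^sub>R v \<in> pos_orthant) (at 0)"
    using open_pos_orthant y by (auto dest: topological_tendstoD)
  moreover have "eventually (\<lambda>t::real. t \<noteq> 0) (at 0)"
    by (simp add: eventually_at_filter)
  ultimately have "eventually (\<lambda>t. ereal ((entropy q (y + t *\<^sub>R v) - entropy q y) / t)
      = (tsallis q (y + t *\<^sub>R v) - tsallis q y) / ereal t) (at 0)"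
    by eventually_elim
       (use pos_orthant_subset_dom[of q] ydom q in \<open>auto simp: tsallis_eq subset_iff\<close>)
  with lim show "((\<lambda>t::real. (tsallis q (y + t *\<^sub>R v) - tsallis q y) / ereal t)
      \<longlongrightarrow> ereal (entropy_gradient q y v)) (at 0)"
    by (rule Lim_transform_eventually)
qed

lemma gateaux_derivative_tsallis:
  assumes "q \<noteq> 0" "y \<in> pos_orthant"
  shows "gateaux_derivative N (tsallis q) y = entropy_gradient q y"
  unfolding gateaux_derivative_def
  using tsallis_has_gateaux_derivative[OF assms] has_gateaux_derivative_unique by blast

lemma divergence_tsallis:
  assumes q: "q \<noteq> 0" and x: "x \<in> tsallis_dom q" and y: "y \<in> pos_orthant"
  shows "divergence N (tsallis q) pos_orthant x y = ereal (entropy_divergence q x y)"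
proof -
  have "y \<in> tsallis_dom q" using y pos_orthant_subset_dom by blast
  then show ?thesis
    using assms by (simp add: divergence_def dom_of_tsallis gateaux_derivative_tsallis tsallis_eq
        entropy_divergence_def term_divergence_def entropy_gradient_def entropy_def sum_subtractf)
qed

end

section \<open>Asymptotic behaviour of the one-variable divergence\<close>

text \<open>
  For \<open>s = 0\<close> only \<open>t powr q\<close> is left: the slope, which may be singular at 0, has cancelled. For large \<open>t\<close> the
  term \<open>t powr q\<close> dominates.
\<close>

lemma term_divergence_formula:
  assumes "q > 0" "q \<noteq> 1" "t > 0"
  shows "term_divergence q s t = s powr q / (q - 1) + t powr q * (1 - q / (q - 1) * s / t)"
proof -
  have "t powr (q - 1) = t powr q / t" using assms by (simp add: powr_diff)
  moreover have "1 / (q - 1) * (a - 1) - 1 / (q - 1) * (b - 1) - q / (q - 1) * (b / t) * (s - t)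
      = a / (q - 1) + b * (1 - q / (q - 1) * s / t)" for a b :: real
    using assms by (simp add: divide_simps) (simp add: algebra_simps)
  ultimately show ?thesis
    using assms by (simp add: term_divergence_def entropy_term_def entropy_slope_def)
qed

lemma term_divergence_at_top:
  assumes "q > 0" "q \<noteq> 1"
  shows "filterlim (\<lambda>t. term_divergence q s t) at_top at_top"
proof -
  have "((\<lambda>t::real. 1 - q / (q - 1) * s / t) \<longlongrightarrow> 1 - 0) at_top"
    by (intro tendsto_intros tendsto_divide_0[OF tendsto_const] filterlim_at_top_imp_at_infinity filterlim_ident)
  moreover have "filterlim (\<lambda>t::real. t powr q) at_top at_top"
    using assms by real_asymp
  ultimately have "filterlim (\<lambda>t. t powr q * (1 - q / (q - 1) * s / t)) at_top at_top"
    by (subst mult.commute) (rule filterlim_tendsto_pos_mult_at_top, auto)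
  then have "filterlim (\<lambda>t. s powr q / (q - 1) + t powr q * (1 - q / (q - 1) * s / t)) at_top at_top"
    by (rule filterlim_tendsto_add_at_top[OF tendsto_const])
  moreover have "eventually (\<lambda>t. s powr q / (q - 1) + t powr q * (1 - q / (q - 1) * s / t)
      = term_divergence q s t) at_top"
    using eventually_gt_at_top[of 0] by eventually_elim (simp add: term_divergence_formula assms)
  ultimately show ?thesis
    by (subst (asm) filterlim_cong[OF refl refl]) auto
qed

lemma term_divergence_tendsto_0:
  assumes q: "q > 0" "q \<noteq> 1" and "s \<ge> 0" and lim: "f \<longlonglongrightarrow> s" and pos: "\<And>i. 0 < f i"
  shows "(\<lambda>i. term_divergence q s (f i)) \<longlonglongrightarrow> 0"
proof (cases "s = 0")
  case True
  have "(\<lambda>i. f i powr q) \<longlonglongrightarrow> 0 powr q"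
    using lim True q pos by (intro tendsto_powr' tendsto_const) (auto intro: always_eventually less_imp_le)
  then show ?thesis using True q pos by (simp add: term_divergence_formula)
next
  case False
  then have "0 < s" using \<open>s \<ge> 0\<close> by simp
  then have "(\<lambda>i. term_divergence q s (f i)) \<longlonglongrightarrow> term_divergence q s s"
    unfolding term_divergence_def entropy_term_def entropy_slope_def
    by (intro tendsto_intros lim) auto
  then show ?thesis by (simp add: term_divergence_def)
qed

text \<open>
  Moving \<open>s\<close> towards \<open>t\<close> until their distance is exactly \<open>\<epsilon>\<close> does not increase the divergence. On the
  compact set of such pairs, with \<open>t = 0\<close> included, the midpoint gap attains a positive minimum.
\<close>

lemma term_divergence_uniform_lower_bound:
  assumes q: "q > 0" "q \<noteq> 1" and "\<epsilon> > 0" "T \<ge> 0"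
  obtains m where "m > 0"
    "\<And>s t. 0 \<le> s \<Longrightarrow> 0 < t \<Longrightarrow> t \<le> T \<Longrightarrow> \<epsilon> \<le> \<bar>s - t\<bar> \<Longrightarrow> m \<le> term_divergence q s t"
proof -
  define G where "G = (\<lambda>p. entropy_term q (fst p) + entropy_term q (snd p)
    - 2 * entropy_term q ((fst p + snd p) / 2))"
  define K where "K = ({0..T + \<epsilon>} \<times> {0..T}) \<inter> {p. \<bar>fst p - snd p\<bar> = \<epsilon>}"
  have dom: "entropy_dom q = {0..}" using q by (simp add: entropy_dom_def)
  have "compact K"
    unfolding K_def
    by (intro compact_Int_closed compact_Times compact_Icc closed_Collect_eq continuous_intros)
  moreover have "(\<epsilon>, 0) \<in> K" using assms by (simp add: K_def)
  then have "K \<noteq> {}" by blast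
  moreover have "continuous_on K G"
    unfolding G_def
    by (intro continuous_intros continuous_on_compose2[OF continuous_on_entropy_term[of q]])
       (auto simp: K_def dom)
  ultimately obtain p where p: "p \<in> K" "\<And>r. r \<in> K \<Longrightarrow> G p \<le> G r"
    using continuous_attains_inf[of K G] by blast
  have "0 < G p"
    unfolding G_def using p(1) q \<open>\<epsilon> > 0\<close>
    by (intro entropy_midpoint_strict) (auto simp: K_def dom)
  moreover have "G p \<le> term_divergence q s t"
    if st: "0 \<le> s" "0 < t" "t \<le> T" "\<epsilon> \<le> \<bar>s - t\<bar>" for s t
  proof -
    define \<alpha> where "\<alpha> = \<epsilon> / \<bar>s - t\<bar>"
    have \<alpha>: "0 < \<alpha>" "\<alpha> \<le> 1" using st \<open>\<epsilon> > 0\<close> by (auto simp: \<alpha>_def)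
    define s' where "s' = \<alpha> * s + (1 - \<alpha>) * t"
    have "s' - t = \<alpha> * (s - t)" by (simp add: s'_def algebra_simps)
    then have "\<bar>s' - t\<bar> = \<alpha> * \<bar>s - t\<bar>" using \<alpha> by (simp add: abs_mult)
    also have "\<dots> = \<epsilon>" using st \<open>\<epsilon> > 0\<close> by (simp add: \<alpha>_def)
    finally have dist: "\<bar>s' - t\<bar> = \<epsilon>" .
    have "0 \<le> s'" using st \<alpha> by (simp add: s'_def)
    then have "(s', t) \<in> K" using dist st by (auto simp: K_def)
    then have "G p \<le> G (s', t)" by (rule p(2))
    also have "\<dots> \<le> term_divergence q s' t"
      using term_divergence_ge_midpoint_gap[of q s' t] q st \<open>0 \<le> s'\<close> by (simp add: G_def dom)
    also have "\<dots> \<le> \<alpha> * term_divergence q s t"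
      unfolding s'_def using q st \<alpha> by (intro term_divergence_scale) (auto simp: dom)
    also have "\<dots> \<le> term_divergence q s t"
      using term_divergence_nonneg[of q s t] q st \<alpha> by (intro mult_left_le_one_le) (auto simp: dom)
    finally show ?thesis .
  qed
  ultimately show ?thesis using that by blast
qed

section \<open>The conditions on Bregman functions\<close>

text \<open>
  Replacing each coordinate by its positive part extends the entropy continuously to the whole space; off
  the orthant the value \<open>\<infinity>\<close> lies above this extension.
\<close>

lemma lower_semicontinuous_tsallis_euclidean:
  fixes x :: "real ^ 'n::finite"
  assumes q: "q > 0" and c: "c < tsallis q x"
  shows "eventually (\<lambda>y. c < tsallis q y) (nhds x)"
proof (cases "x \<in> tsallis_dom q")
  case True
  define g where "g = (\<lambda>y :: real ^ 'n. \<Sum>k\<in>UNIV. entropy_term q (max 0 (y $ k)))"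
  have g_eq: "entropy q y = g y" if "y \<in> tsallis_dom q" for y
    using tsallis_dom_component_nonneg[OF that] by (simp add: g_def entropy_def max_def)
  have "continuous_on UNIV g"
    unfolding g_def
    by (intro continuous_intros continuous_on_compose2[OF continuous_on_entropy_term[of q]])
       (use q in \<open>auto simp: entropy_dom_def\<close>)
  then have "(g \<longlongrightarrow> g x) (nhds x)"
    by (simp add: continuous_on_eq_continuous_at isCont_def tendsto_nhds_iff)
  then have "((\<lambda>y. ereal (g y)) \<longlongrightarrow> ereal (g x)) (nhds x)"
    by (rule tendsto_ereal)
  moreover have "c < ereal (g x)" using c True q g_eq by (simp add: tsallis_eq)
  ultimately have "eventually (\<lambda>y. c < ereal (g y)) (nhds x)"
    by (rule order_tendstoD)
  then show ?thesis
    by eventually_elim (use q g_eq in \<open>auto simp: tsallis_eq\<close>)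
next
  case False
  have "open (- tsallis_dom q :: (real ^ 'n) set)"
    using q closed_nonneg_orthant by (simp add: tsallis_dom_pos open_closed)
  then have "eventually (\<lambda>y. y \<in> - tsallis_dom q) (nhds x)"
    using False by (intro eventually_nhds_in_open) auto
  then show ?thesis
    by eventually_elim (use q c False in \<open>auto simp: tsallis_eq\<close>)
qed

lemma estrictly_convex_on_tsallis:
  fixes q :: real
  assumes q: "q \<noteq> 0" "q \<noteq> 1"
  shows "estrictly_convex_on (tsallis_dom q) (tsallis q :: real ^ 'n::finite \<Rightarrow> ereal)"
  unfolding estrictly_convex_on_def
proof (intro ballI impI)
  fix x y :: "real ^ 'n" and \<alpha> :: real
  assume xy: "x \<in> tsallis_dom q" "y \<in> tsallis_dom q" "x \<noteq> y" and "\<alpha> \<in> {0<..<1}"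
  then have \<alpha>: "0 < \<alpha>" "\<alpha> < 1" by auto
  from xy obtain k where k: "x $ k \<noteq> y $ k" by (auto simp: vec_eq_iff)
  have "(\<Sum>k\<in>UNIV. entropy_term q (\<alpha> * x $ k + (1 - \<alpha>) * y $ k))
      < (\<Sum>k\<in>UNIV. \<alpha> * entropy_term q (x $ k) + (1 - \<alpha>) * entropy_term q (y $ k))"
  proof (rule sum_strict_mono_ex1)
    show "\<forall>k\<in>UNIV. entropy_term q (\<alpha> * x $ k + (1 - \<alpha>) * y $ k)
      \<le> \<alpha> * entropy_term q (x $ k) + (1 - \<alpha>) * entropy_term q (y $ k)"
      using xy q \<alpha> by (intro ballI entropy_term_convex) (auto simp: tsallis_dom_def)
    show "\<exists>k\<in>UNIV. entropy_term q (\<alpha> * x $ k + (1 - \<alpha>) * y $ k)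
      < \<alpha> * entropy_term q (x $ k) + (1 - \<alpha>) * entropy_term q (y $ k)"
      using xy q \<alpha> k by (intro bexI[of _ k] entropy_term_strictly_convex) (auto simp: tsallis_dom_def)
  qed simp
  then have "entropy q (\<alpha> *\<^sub>R x + (1 - \<alpha>) *\<^sub>R y) < \<alpha> * entropy q x + (1 - \<alpha>) * entropy q y"
    by (simp add: entropy_def sum.distrib sum_distrib_left)
  then show "tsallis q (\<alpha> *\<^sub>R x + (1 - \<alpha>) *\<^sub>R y) < ereal \<alpha> * tsallis q x + ereal (1 - \<alpha>) * tsallis q y"
    using xy q \<alpha> convex_tsallis_dom[of x q y \<alpha>] by (simp add: tsallis_eq)
qed

text \<open>
  By convexity in the first argument, the divergence in each coordinate grows at least linearly beyond
  \<open>y $ k + 1\<close>, with slope \<open>D\<close>.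
\<close>

lemma bounded_left_level_set:
  fixes y :: "real ^ 'n::finite"
  assumes q: "q > 0" "q \<noteq> 1" and y: "y \<in> pos_orthant"
  shows "bounded {x \<in> tsallis_dom q. entropy_divergence q x y \<le> \<gamma>}"
proof (rule bounded_if_components_bounded)
  fix k
  have "0 < y $ k" using y by (simp add: pos_orthant_def)
  define D where "D = term_divergence q (y $ k + 1) (y $ k)"
  have "0 < D"
    unfolding D_def using q \<open>0 < y $ k\<close> by (intro term_divergence_pos) (auto simp: entropy_dom_def)
  have "\<bar>x $ k\<bar> \<le> y $ k + max 1 (\<gamma> / D)"
    if x: "x \<in> tsallis_dom q" "entropy_divergence q x y \<le> \<gamma>" for x
  proof (cases "x $ k \<le> y $ k + 1")
    case True
    then show ?thesis using tsallis_dom_component_nonneg[OF x(1), of k] by auto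
  next
    case False
    define \<alpha> where "\<alpha> = 1 / (x $ k - y $ k)"
    have \<alpha>: "0 < \<alpha>" "\<alpha> \<le> 1" using False by (auto simp: \<alpha>_def)
    have "\<alpha> * (x $ k - y $ k) = 1" using False by (simp add: \<alpha>_def)
    then have "\<alpha> * x $ k + (1 - \<alpha>) * y $ k = y $ k + 1" by (simp add: algebra_simps)
    then have "D \<le> \<alpha> * term_divergence q (x $ k) (y $ k)"
      using term_divergence_scale[of q "x $ k" "y $ k" \<alpha>] x q \<alpha> \<open>0 < y $ k\<close>
      by (auto simp: D_def tsallis_dom_def)
    also have "\<dots> \<le> \<alpha> * \<gamma>"
      using term_divergence_le_entropy_divergence[of q x y k] x y q \<alpha> by (intro mult_left_mono) auto
    finally have "x $ k - y $ k \<le> \<gamma> / D"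
      using False \<open>0 < D\<close> by (simp add: \<alpha>_def field_simps)
    then show ?thesis using tsallis_dom_component_nonneg[OF x(1), of k] by auto
  qed
  then show "\<exists>T. \<forall>x\<in>{x \<in> tsallis_dom q. entropy_divergence q x y \<le> \<gamma>}. \<bar>x $ k\<bar> \<le> T" by blast
qed

lemma bounded_right_level_set:
  fixes x :: "real ^ 'n::finite"
  assumes q: "q > 0" "q \<noteq> 1" and x: "x \<in> tsallis_dom q"
  shows "bounded {y \<in> pos_orthant. entropy_divergence q x y \<le> \<gamma>}"
proof (rule bounded_if_components_bounded)
  fix k
  have "eventually (\<lambda>t. \<gamma> < term_divergence q (x $ k) t) at_top"
    using term_divergence_at_top[OF q] by (auto simp: filterlim_at_top_dense)
  then obtain T where T: "\<And>t. T \<le> t \<Longrightarrow> \<gamma> < term_divergence q (x $ k) t"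
    by (auto simp: eventually_at_top_linorder)
  have "\<bar>y $ k\<bar> \<le> T" if y: "y \<in> pos_orthant" "entropy_divergence q x y \<le> \<gamma>" for y
  proof -
    have "0 < y $ k" using y by (simp add: pos_orthant_def)
    moreover have "term_divergence q (x $ k) (y $ k) \<le> \<gamma>"
      using order_trans[OF term_divergence_le_entropy_divergence y(2)] x y(1) q by simp
    ultimately show ?thesis using T[of "y $ k"] by linarith
  qed
  then show "\<exists>T. \<forall>y\<in>{y \<in> pos_orthant. entropy_divergence q x y \<le> \<gamma>}. \<bar>y $ k\<bar> \<le> T" by blast
qed

lemma entropy_divergence_consistent:
  fixes x y :: "nat \<Rightarrow> real ^ 'n::finite"
  assumes q: "q > 0" "q \<noteq> 1" and x: "\<And>i. x i \<in> tsallis_dom q" and y: "\<And>i. y i \<in> pos_orthant"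
    and bdd: "bounded (range y)" and lim: "(\<lambda>i. entropy_divergence q (x i) (y i)) \<longlonglongrightarrow> 0"
  shows "(\<lambda>i. x i - y i) \<longlonglongrightarrow> 0"
proof (rule vec_tendstoI)
  fix k
  obtain T where "\<And>i. norm (y i) \<le> T" using bdd by (auto simp: bounded_iff)
  then have T: "\<bar>y i $ k\<bar> \<le> T" for i
    using component_le_norm_cart[of "y i" k] order_trans by blast
  have "T \<ge> 0" using T[of 0] by linarith
  have "(\<lambda>i. x i $ k - y i $ k) \<longlonglongrightarrow> 0"
  proof (rule tendstoI)
    fix \<epsilon> :: real assume "\<epsilon> > 0"
    obtain m where m: "m > 0"
      "\<And>s t. 0 \<le> s \<Longrightarrow> 0 < t \<Longrightarrow> t \<le> T \<Longrightarrow> \<epsilon> \<le> \<bar>s - t\<bar> \<Longrightarrow> m \<le> term_divergence q s t"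
      using term_divergence_uniform_lower_bound[OF q \<open>\<epsilon> > 0\<close> \<open>T \<ge> 0\<close>] by metis
    have "eventually (\<lambda>i. entropy_divergence q (x i) (y i) < m) sequentially"
      using lim m(1) by (rule order_tendstoD)
    then show "eventually (\<lambda>i. dist (x i $ k - y i $ k) 0 < \<epsilon>) sequentially"
    proof eventually_elim
      case (elim i)
      have "term_divergence q (x i $ k) (y i $ k) < m"
        using le_less_trans[OF term_divergence_le_entropy_divergence elim] q x y by simp
      moreover have "0 < y i $ k" using y[of i] by (simp add: pos_orthant_def)
      ultimately show ?case
        using m(2)[of "x i $ k" "y i $ k"] T[of i] tsallis_dom_component_nonneg[OF x, of i k]
        by (force simp: dist_real_def)
    qed
  qed
  then show "(\<lambda>i. (x i - y i) $ k) \<longlonglongrightarrow> 0 $ k" by simp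
qed

context comparable_norm
begin

lemma sequentially_consistent_tsallis:
  assumes q: "q > 0" "q \<noteq> 1"
  shows "sequentially_consistent N (tsallis q) pos_orthant"
  unfolding sequentially_consistent_def
proof (intro allI impI)
  fix x y :: "nat \<Rightarrow> real ^ 'n"
  assume *: "(\<forall>i. x i \<in> dom_of (tsallis q)) \<and> (\<forall>i. y i \<in> pos_orthant) \<and> norm_bounded N (range y) \<and>
    (\<lambda>i. divergence N (tsallis q) pos_orthant (x i) (y i)) \<longlonglongrightarrow> 0"
  then have "divergence N (tsallis q) pos_orthant (x i) (y i) = ereal (entropy_divergence q (x i) (y i))" for i
    using q by (intro divergence_tsallis) (auto simp: dom_of_tsallis)
  then have "(\<lambda>i. entropy_divergence q (x i) (y i)) \<longlonglongrightarrow> 0"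
    using * by (simp add: zero_ereal_def)
  then have "(\<lambda>i. x i - y i) \<longlonglongrightarrow> 0"
    using * q by (intro entropy_divergence_consistent[OF q]) (auto simp: dom_of_tsallis norm_bounded_iff)
  then show "(\<lambda>i. N (x i - y i)) \<longlonglongrightarrow> 0" by (simp add: N_tendsto_0_iff)
qed

lemma limiting_difference_tsallis:
  assumes q: "q > 0" "q \<noteq> 1"
  shows "limiting_difference_property N (tsallis q) pos_orthant"
  unfolding limiting_difference_property_def
proof (intro ballI allI impI)
  fix x z :: "real ^ 'n" and y :: "nat \<Rightarrow> real ^ 'n"
  assume "x \<in> dom_of (tsallis q)" and z: "z \<in> pos_orthant"
    and y: "(\<forall>i. y i \<in> pos_orthant) \<and> weakly_converges N y z"
  then have x: "x \<in> tsallis_dom q" using q by (simp add: dom_of_tsallis)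
  have zdom: "z \<in> tsallis_dom q" using z pos_orthant_subset_dom by blast
  have "(\<lambda>i. entropy_slope q (y i $ k)) \<longlonglongrightarrow> entropy_slope q (z $ k)" for k
  proof (rule isCont_tendsto_compose[where g = "entropy_slope q" and l = "z $ k"])
    have "0 < z $ k" using z by (simp add: pos_orthant_def)
    then show "isCont (entropy_slope q) (z $ k)"
      using q entropy_slope_deriv by (intro DERIV_isCont) auto
    show "(\<lambda>i. y i $ k) \<longlonglongrightarrow> z $ k"
      using weakly_converges_imp_tendsto y by (intro tendsto_vec_nth) auto
  qed
  then have "(\<lambda>i. \<Sum>k\<in>UNIV. entropy_term q (x $ k) - entropy_term q (z $ k)
      - entropy_slope q (y i $ k) * (x $ k - z $ k))
    \<longlonglongrightarrow> (\<Sum>k\<in>UNIV. entropy_term q (x $ k) - entropy_term q (z $ k)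
      - entropy_slope q (z $ k) * (x $ k - z $ k))"
    by (intro tendsto_intros)
  moreover have "(\<Sum>k\<in>UNIV. entropy_term q (x $ k) - entropy_term q (z $ k)
      - entropy_slope q (y i $ k) * (x $ k - z $ k))
    = entropy_divergence q x (y i) - entropy_divergence q z (y i)" for i
    unfolding entropy_divergence_def sum_subtractf[symmetric]
    by (intro sum.cong) (auto simp: term_divergence_def algebra_simps)
  moreover have "(\<Sum>k\<in>UNIV. entropy_term q (x $ k) - entropy_term q (z $ k)
      - entropy_slope q (z $ k) * (x $ k - z $ k)) = entropy_divergence q x z"
    by (simp add: entropy_divergence_def term_divergence_def)
  ultimately have "(\<lambda>i. ereal (entropy_divergence q x (y i) - entropy_divergence q z (y i)))
      \<longlonglongrightarrow> ereal (entropy_divergence q x z)"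
    by simp
  then show "(\<lambda>i. divergence N (tsallis q) pos_orthant x (y i)
      - divergence N (tsallis q) pos_orthant z (y i)) \<longlonglongrightarrow> divergence N (tsallis q) pos_orthant x z"
    using q x z zdom y by (simp add: divergence_tsallis)
qed

lemma norm_bounded_left_level_set:
  assumes "q > 0" "q \<noteq> 1" "y \<in> pos_orthant"
  shows "norm_bounded N {x \<in> dom_of (tsallis q). divergence N (tsallis q) pos_orthant x y \<le> ereal \<gamma>}"
proof -
  have "{x \<in> dom_of (tsallis q). divergence N (tsallis q) pos_orthant x y \<le> ereal \<gamma>}
    = {x \<in> tsallis_dom q. entropy_divergence q x y \<le> \<gamma>}"
    using assms by (auto simp: dom_of_tsallis divergence_tsallis)
  then show ?thesis using bounded_left_level_set[OF assms] by (simp add: norm_bounded_iff)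
qed

lemma bregman_function_tsallis:
  assumes q: "q > 0" "q \<noteq> 1"
  shows "bregman_function N (tsallis q) pos_orthant"
proof -
  have q0: "q \<noteq> 0" using q by simp
  have "proper_values (tsallis q :: real ^ 'n \<Rightarrow> ereal)"
    using q by (auto simp: proper_values_def tsallis_eq)
  moreover have "pos_orthant = norm_topology N interior_of dom_of (tsallis q)"
    using q by (simp add: norm_topology_eq dom_of_tsallis interior_tsallis_dom)
  moreover have "(vec 1 :: real ^ 'n) \<in> pos_orthant" by (simp add: pos_orthant_def)
  then have "(pos_orthant :: (real ^ 'n) set) \<noteq> {}" by blast
  moreover have "\<forall>y\<in>pos_orthant. \<exists>L. has_gateaux_derivative N (tsallis q) L y"
    using tsallis_has_gateaux_derivative[OF q0] by blast
  moreover have "lower_semicontinuous N (tsallis q)"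
    using lower_semicontinuous_tsallis_euclidean[OF q(1)]
    by (auto simp: lower_semicontinuous_def norm_topology_eq nhdsin_def nhds_def)
  moreover have "norm_bounded N {y \<in> pos_orthant. divergence N (tsallis q) pos_orthant x y \<le> ereal \<gamma>}"
    if "x \<in> dom_of (tsallis q)" for x \<gamma>
  proof -
    have x: "x \<in> tsallis_dom q" using that q by (simp add: dom_of_tsallis)
    then have "{y \<in> pos_orthant. divergence N (tsallis q) pos_orthant x y \<le> ereal \<gamma>}
      = {y \<in> pos_orthant. entropy_divergence q x y \<le> \<gamma>}"
      using q by (auto simp: divergence_tsallis)
    then show ?thesis using bounded_right_level_set[OF q x] by (simp add: norm_bounded_iff)
  qed
  moreover have "(\<lambda>i. divergence N (tsallis q) pos_orthant x (y i)) \<longlonglongrightarrow> 0"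
    if "x \<in> dom_of (tsallis q)" and y: "(\<forall>i. y i \<in> pos_orthant) \<and> (\<lambda>i. N (x - y i)) \<longlonglongrightarrow> 0" for x y
  proof -
    have x: "x \<in> tsallis_dom q" using that q by (simp add: dom_of_tsallis)
    have "(\<lambda>i. N (y i - x)) \<longlonglongrightarrow> 0" using y by (subst N_commute) simp
    then have "y \<longlonglongrightarrow> x" by (simp add: N_diff_tendsto_0_iff)
    then have "(\<lambda>i. term_divergence q (x $ k) (y i $ k)) \<longlonglongrightarrow> 0" for k
      using y tsallis_dom_component_nonneg[OF x, of k] q
      by (intro term_divergence_tendsto_0 tendsto_vec_nth) (auto simp: pos_orthant_def)
    then have "(\<lambda>i. entropy_divergence q x (y i)) \<longlonglongrightarrow> 0"
      unfolding entropy_divergence_def by (intro tendsto_null_sum)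
    then have "(\<lambda>i. ereal (entropy_divergence q x (y i))) \<longlonglongrightarrow> ereal 0" by (rule tendsto_ereal)
    then show ?thesis using x y q by (simp add: divergence_tsallis zero_ereal_def)
  qed
  moreover have "(\<lambda>i. N (x i - z)) \<longlonglongrightarrow> 0"
    if *: "(\<forall>i. x i \<in> dom_of (tsallis q)) \<and> norm_bounded N (range x) \<and> (\<forall>i. y i \<in> pos_orthant) \<and>
        (\<lambda>i. divergence N (tsallis q) pos_orthant (x i) (y i)) \<longlonglongrightarrow> 0 \<and> (\<lambda>i. N (y i - z)) \<longlonglongrightarrow> 0"
    for x y :: "nat \<Rightarrow> real ^ 'n" and z
  proof -
    have yz: "y \<longlonglongrightarrow> z" using * by (simp add: N_diff_tendsto_0_iff)
    then have "norm_bounded N (range y)"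
      using convergent_imp_bounded norm_bounded_iff by blast
    then have "(\<lambda>i. N (x i - y i)) \<longlonglongrightarrow> 0"
      using sequentially_consistent_tsallis[OF q] * unfolding sequentially_consistent_def by blast
    then have "(\<lambda>i. x i - y i + y i) \<longlonglongrightarrow> 0 + z"
      unfolding N_tendsto_0_iff by (rule tendsto_add[OF _ yz])
    then show ?thesis by (simp add: N_diff_tendsto_0_iff)
  qed
  ultimately show ?thesis
    using econvex_tsallis[OF q0 q(2)]
      estrictly_convex_on_tsallis[OF q0 q(2), folded dom_of_tsallis[OF q0]]
    unfolding bregman_function_def by auto
qed

text \<open>
  As \<open>t\<close> goes to infinity, both \<open>t powr q\<close> and the slope times \<open>t\<close> tend to 0, so the divergence
  of \<open>vec 1\<close> from \<open>vec t\<close> remains bounded: a level set of the second argument contains a ray.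
\<close>

lemma not_bregman_function_tsallis_neg:
  assumes q: "q < 0"
  shows "\<not> bregman_function N (tsallis q) Z"
proof
  assume breg: "bregman_function N (tsallis q) Z"
  define e :: "real \<Rightarrow> real ^ 'n" where "e t = vec t" for t
  have e: "e t \<in> pos_orthant" if "1 \<le> t" for t
    using that by (simp add: e_def pos_orthant_def)
  have edom: "e 1 \<in> tsallis_dom q"
    using e[of 1] q by (simp add: tsallis_dom_neg)
  define \<gamma> where "\<gamma> = real CARD('n) * (1 / (1 - q))"
  have "Z = pos_orthant"
    using breg q
    by (simp add: bregman_function_def norm_topology_eq dom_of_tsallis interior_tsallis_dom)
  moreover have "e 1 \<in> dom_of (tsallis q)" using edom q by (simp add: dom_of_tsallis)
  ultimately have "norm_bounded N {y \<in> pos_orthant. divergence N (tsallis q) pos_orthant (e 1) y \<le> ereal \<gamma>}"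
    using breg by (simp add: bregman_function_def)
  then obtain M where M: "\<And>y. y \<in> pos_orthant \<Longrightarrow> divergence N (tsallis q) pos_orthant (e 1) y \<le> ereal \<gamma> \<Longrightarrow> N y \<le> M"
    by (auto simp: norm_bounded_def)
  have bound: "term_divergence q 1 t \<le> 1 / (1 - q)" if "1 \<le> t" for t
  proof -
    have "entropy_slope q t \<le> 0"
      unfolding entropy_slope_def using q by (intro mult_nonpos_nonneg divide_nonneg_nonpos) auto
    then have "0 \<le> entropy_slope q t * (1 - t)"
      using that by (simp add: mult_nonpos_nonpos)
    moreover have "- entropy_term q t \<le> 1 / (1 - q)"
      using q mult_nonpos_nonneg[of q "t powr q"] order_trans[of "q * t powr q" 0 "t powr q"]
      by (simp add: entropy_term_def field_simps)
    moreover have "entropy_term q 1 = 0" by (simp add: entropy_term_def)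
    ultimately show ?thesis by (simp add: term_divergence_def)
  qed
  have "t * N (vec 1) \<le> M" if "1 \<le> t" for t
  proof -
    have "entropy_divergence q (e 1) (e t) \<le> \<gamma>"
      using mult_left_mono[OF bound[OF that], of "real CARD('n)"]
      by (simp add: entropy_divergence_def e_def \<gamma>_def)
    then have "N (e t) \<le> M"
      using M[OF e[OF that]] e[OF that] edom q by (simp add: divergence_tsallis)
    moreover have "e t = t *\<^sub>R vec 1" by (simp add: e_def vec_eq_iff)
    ultimately show ?thesis using that by (simp add: N_scale)
  qed
  from this[of "max 1 (M / N (vec 1) + 1)"] have "(M / N (vec 1) + 1) * N (vec 1) \<le> M"
    using N_vec_1_pos by (smt (verit) mult_right_mono)
  then show False using N_vec_1_pos by (simp add: field_simps)
qed

end

theorem mainTheorem11: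
  fixes N :: "real ^ 'n::finite \<Rightarrow> real" and q c2 cinf :: real
  assumes "is_norm N"
    and "q \<noteq> 0" and "q \<noteq> 1"
    and "c2 > 0" and "cinf > 0"
    and "\<And>v. c2 * N v \<le> norm v"
    and "\<And>v. infnorm v \<le> cinf * N v"
  shows
    \<comment> \<open>(a)\<close>
    "(q = 2 \<longrightarrow> strong_convexity_parameter N (tsallis q) nonneg_orthant (2 * c2^2)) \<and>
     (q < 2 \<longrightarrow>
        (\<forall>S. S \<noteq> {} \<and> norm_bounded N S \<and> convex S \<and> S \<subseteq> dom_of (tsallis q)
           \<longrightarrow> strongly_convex_on N (tsallis q) S) \<and>
        (\<forall>S M. S \<noteq> {} \<and> norm_bounded N S \<and> convex S \<and> S \<subseteq> pos_orthant \<and> (\<forall>x\<in>S. N x \<le> M)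
           \<longrightarrow> strong_convexity_parameter N (tsallis q) S
                 (\<bar>q\<bar> * c2^2 / (cinf * M) powr (2 - q)))) \<and>
     (q > 2 \<longrightarrow>
        (\<forall>V. V \<noteq> {} \<and> V \<subseteq> pos_orthant \<and>
             norm_setdist N V (norm_topology N frontier_of pos_orthant) > 0
           \<longrightarrow> strongly_convex_on N (tsallis q) V)) \<and>
     \<comment> \<open>(b)\<close>
     (q < 2 \<longrightarrow>
        (\<forall>x\<in>dom_of (tsallis q).
           uniformly_convex_rel N (tsallis q) {x} (pos_orthant \<inter> {w. N w > 2 * N x})
             (\<lambda>t. if t = 0 then 0
                  else ereal (\<bar>q\<bar> * c2^2 / (cinf powr (2 - q) * 2 powr (3 - q)) * t powr q)))) \<and>
     \<comment> \<open>(c)\<close>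
     (q > 0 \<and> q \<noteq> 2 \<longrightarrow> \<not> strongly_convex_on N (tsallis q) pos_orthant) \<and>
     (q = 1/2 \<longrightarrow> \<not> uniformly_convex_on N (tsallis q) pos_orthant) \<and>
     \<comment> \<open>(d)\<close>
     (q > 0 \<longrightarrow>
        bregman_function N (tsallis q) pos_orthant \<and>
        sequentially_consistent N (tsallis q) pos_orthant \<and>
        limiting_difference_property N (tsallis q) pos_orthant \<and>
        (\<forall>y\<in>pos_orthant. \<forall>\<gamma>::real.
           norm_bounded N {x \<in> dom_of (tsallis q).
             divergence N (tsallis q) pos_orthant x y \<le> ereal \<gamma>})) \<and>
     (q < 0 \<longrightarrow> \<not> (\<exists>Z. bregman_function N (tsallis q) Z))"
proof -
  interpret comparable_norm N c2 cinf
    by standard (use assms in auto)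
  note q = \<open>q \<noteq> 0\<close> \<open>q \<noteq> 1\<close>
  have a1: "strong_convexity_parameter N (tsallis q) nonneg_orthant (2 * c2^2)" if "q = 2"
  proof (rule strong_convexity_parameterI)
    have "(0 :: real ^ 'n) \<in> nonneg_orthant" by (simp add: nonneg_orthant_def)
    then show "(nonneg_orthant :: (real ^ 'n) set) \<noteq> {}" by blast
    show "nonneg_orthant \<subseteq> tsallis_dom q" using that by (simp add: tsallis_dom_pos)
    fix x y :: "real ^ 'n" and k u
    assume "x \<in> nonneg_orthant" "y \<in> nonneg_orthant" "min (x $ k) (y $ k) < u"
    then have "0 < u" using tsallis_dom_between_pos[of x q y] that by (simp add: tsallis_dom_pos)
    then show "2 \<le> \<bar>q\<bar> * u powr (q - 2)" using that by simp
  qed (use q in auto)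
  have a2: "strongly_convex_on N (tsallis q) S"
    if S: "q < 2" "S \<noteq> {}" "norm_bounded N S" "S \<subseteq> dom_of (tsallis q)" for S
  proof -
    obtain M where M: "\<And>x. x \<in> S \<Longrightarrow> N x \<le> M" using S by (auto simp: norm_bounded_def)
    have "strong_convexity_parameter N (tsallis q) S (\<bar>q\<bar> * c2\<^sup>2 / (cinf * (\<bar>M\<bar> + 1)) powr (2 - q))"
      using S q by (intro strong_convexity_parameter_bounded)
        (auto simp: dom_of_tsallis intro: order_trans[OF M])
    then show ?thesis by (auto simp: strongly_convex_on_def)
  qed
  have a3: "strong_convexity_parameter N (tsallis q) S (\<bar>q\<bar> * c2^2 / (cinf * M) powr (2 - q))"
    if S: "q < 2" "S \<noteq> {}" "S \<subseteq> pos_orthant" "\<forall>x\<in>S. N x \<le> M" for S M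
  proof (rule strong_convexity_parameter_bounded)
    obtain x where x: "x \<in> S" using S by blast
    then have "x \<noteq> 0" using S by (auto simp: pos_orthant_def)
    then show "0 < M" using N_pos[of x] S x by force
  qed (use S q pos_orthant_subset_dom[of q] in auto)
  show ?thesis
  proof (intro conjI impI allI ballI)
    show "strong_convexity_parameter N (tsallis q) nonneg_orthant (2 * c2^2)" if "q = 2"
      using a1 that .
    show "strongly_convex_on N (tsallis q) S"
      if "q < 2" "S \<noteq> {} \<and> norm_bounded N S \<and> convex S \<and> S \<subseteq> dom_of (tsallis q)" for S
      using a2 that by blast
    show "strong_convexity_parameter N (tsallis q) S (\<bar>q\<bar> * c2^2 / (cinf * M) powr (2 - q))"
      if "q < 2" "S \<noteq> {} \<and> norm_bounded N S \<and> convex S \<and> S \<subseteq> pos_orthant \<and> (\<forall>x\<in>S. N x \<le> M)" for S M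
      using a3 that by blast
    show "strongly_convex_on N (tsallis q) V"
      if "q > 2" "V \<noteq> {} \<and> V \<subseteq> pos_orthant \<and>
             norm_setdist N V (norm_topology N frontier_of pos_orthant) > 0" for V
      using strongly_convex_away_from_boundary that by blast
    show "uniformly_convex_rel N (tsallis q) {x} (pos_orthant \<inter> {w. N w > 2 * N x})
             (\<lambda>t. if t = 0 then 0
                  else ereal (\<bar>q\<bar> * c2^2 / (cinf powr (2 - q) * 2 powr (3 - q)) * t powr q))"
      if "q < 2" "x \<in> dom_of (tsallis q)" for x
      using uniformly_convex_rel_far[OF q that(1)] that(2)
      by (simp only: dom_of_tsallis[OF q(1)])
    show "\<not> strongly_convex_on N (tsallis q) pos_orthant" if "q > 0 \<and> q \<noteq> 2"
      using not_strongly_convex that by blast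
    show "\<not> uniformly_convex_on N (tsallis q) pos_orthant" if "q = 1/2"
      unfolding that by (rule not_uniformly_convex_half)
    show "bregman_function N (tsallis q) pos_orthant" if "q > 0"
      using bregman_function_tsallis that q by blast
    show "sequentially_consistent N (tsallis q) pos_orthant" if "q > 0"
      using sequentially_consistent_tsallis that q by blast
    show "limiting_difference_property N (tsallis q) pos_orthant" if "q > 0"
      using limiting_difference_tsallis that q by blast
    show "norm_bounded N {x \<in> dom_of (tsallis q).
             divergence N (tsallis q) pos_orthant x y \<le> ereal \<gamma>}" if "q > 0" "y \<in> pos_orthant" for y \<gamma>
      using norm_bounded_left_level_set that q by blast
    show "\<not> (\<exists>Z. bregman_function N (tsallis q) Z)" if "q < 0"
      using not_bregman_function_tsallis_neg that by blast
  qed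
qed

end
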